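(* There does not exist a fusion category whose Grothendieck ring is isomorphic to the ring $R_7$ or to the ring $R_8$, where $R_7$ and $R_8$ are the commutative based rings with unit $\mathbf 1$ and $\mathbb{Z}$-basis $\mathbf 1,X,Y,Z,M,N$ and products \[ X^2=Y,\ XY=\mathbf 1,\ Y^2=X,\ XZ=YZ=Z,\ Z^2=\mathbf 1+X+Y+2Z, \] \[ XM=YM=M,\ XN=YN=N,\ ZM=M+2N,\ ZN=2M+N, \] together with, in $R_7$: $M^2=N^2=\mathbf 1+X+Y+Z$, $MN=NM=2Z$; and in $R_8$: $M^2=N^2=2Z$, $MN=NM=\mathbf 1+X+Y+Z$.
   Context: Fusion categories are over $\mathbb{C}$. The Grothendieck ring of a fusion category is a based ring whose basis is the set of isomorphism classes of simple objects; isomorphism means ring isomorphism carrying basis to basis. *)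

theory Defs
  imports "HOL-Algebra.Algebraic_Closure_Type" "HOL-Algebra.QuotRing"
    "HOL-Algebra.Free_Abelian_Groups" Complex_Main
begin

section \<open>Categories\<close>

text \<open>
  Composition is written in the usual order, \<open>g \<cdot> f\<close> being \<open>f\<close> followed by \<open>g\<close>.  All
  operations are total functions; the axioms only constrain them on composable arrows between
  objects of the category.
\<close>

record ('o, 'm) category_data =
  Obj :: "'o set"
  Arr :: "'m set"
  Dom :: "'m \<Rightarrow> 'o"
  Cod :: "'m \<Rightarrow> 'o"
  ident :: "'o \<Rightarrow> 'm" (\<open>\<ii>\<index>\<close>)
  comp_arr :: "'m \<Rightarrow> 'm \<Rightarrow> 'm" (infixl \<open>\<cdot>\<index>\<close> 65)

definition Hom :: "('o, 'm, 'z) category_data_scheme \<Rightarrow> 'o \<Rightarrow> 'o \<Rightarrow> 'm set" where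
  "Hom C a b = {f \<in> Arr C. Dom C f = a \<and> Cod C f = b}"

locale category =
  fixes C :: "('o, 'm, 'z) category_data_scheme" (structure)
  assumes dom_closed: "f \<in> Arr C \<Longrightarrow> Dom C f \<in> Obj C"
    and cod_closed: "f \<in> Arr C \<Longrightarrow> Cod C f \<in> Obj C"
    and id_closed: "a \<in> Obj C \<Longrightarrow> \<ii> a \<in> Hom C a a"
    and comp_closed: "\<lbrakk>f \<in> Hom C a b; g \<in> Hom C b c\<rbrakk> \<Longrightarrow> g \<cdot> f \<in> Hom C a c"
    and comp_id_right: "f \<in> Hom C a b \<Longrightarrow> f \<cdot> \<ii> a = f"
    and comp_id_left: "f \<in> Hom C a b \<Longrightarrow> \<ii> b \<cdot> f = f"
    and comp_assoc:
      "\<lbrakk>f \<in> Hom C a b; g \<in> Hom C b c; h \<in> Hom C c d\<rbrakk> \<Longrightarrow> h \<cdot> (g \<cdot> f) = (h \<cdot> g) \<cdot> f"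

definition inverse_arrows :: "('o, 'm, 'z) category_data_scheme \<Rightarrow> 'm \<Rightarrow> 'm \<Rightarrow> bool" where
  "inverse_arrows C f g \<longleftrightarrow>
    f \<in> Arr C \<and> g \<in> Hom C (Cod C f) (Dom C f) \<and>
    g \<cdot> f = \<ii> (Dom C f) \<and> f \<cdot> g = \<ii> (Cod C f)"
  for C (structure)

definition iso_arrow :: "('o, 'm, 'z) category_data_scheme \<Rightarrow> 'm \<Rightarrow> bool" where
  "iso_arrow C f \<longleftrightarrow> (\<exists>g. inverse_arrows C f g)"

definition inv_arrow :: "('o, 'm, 'z) category_data_scheme \<Rightarrow> 'm \<Rightarrow> 'm" where
  "inv_arrow C f = (THE g. inverse_arrows C f g)"

definition isomorphic :: "('o, 'm, 'z) category_data_scheme \<Rightarrow> 'o \<Rightarrow> 'o \<Rightarrow> bool" where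
  "isomorphic C a b \<longleftrightarrow> (\<exists>f \<in> Hom C a b. iso_arrow C f)"

definition mono_arrow :: "('o, 'm, 'z) category_data_scheme \<Rightarrow> 'm \<Rightarrow> bool" where
  "mono_arrow C f \<longleftrightarrow> f \<in> Arr C \<and>
    (\<forall>a \<in> Obj C. \<forall>g \<in> Hom C a (Dom C f). \<forall>h \<in> Hom C a (Dom C f). f \<cdot> g = f \<cdot> h \<longrightarrow> g = h)"
  for C (structure)

definition epi_arrow :: "('o, 'm, 'z) category_data_scheme \<Rightarrow> 'm \<Rightarrow> bool" where
  "epi_arrow C f \<longleftrightarrow> f \<in> Arr C \<and>
    (\<forall>a \<in> Obj C. \<forall>g \<in> Hom C (Cod C f) a. \<forall>h \<in> Hom C (Cod C f) a. g \<cdot> f = h \<cdot> f \<longrightarrow> g = h)"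
  for C (structure)

definition zero_object :: "('o, 'm, 'z) category_data_scheme \<Rightarrow> 'o \<Rightarrow> bool" where
  "zero_object C z \<longleftrightarrow> z \<in> Obj C \<and>
    (\<forall>a \<in> Obj C. (\<exists>!f. f \<in> Hom C z a) \<and> (\<exists>!f. f \<in> Hom C a z))"

text \<open>An object is simple if it is nonzero and its only subobjects are zero and itself.\<close>

definition simple_object :: "('o, 'm, 'z) category_data_scheme \<Rightarrow> 'o \<Rightarrow> bool" where
  "simple_object C s \<longleftrightarrow> s \<in> Obj C \<and> \<not> zero_object C s \<and>
    (\<forall>i. mono_arrow C i \<and> Cod C i = s \<longrightarrow> zero_object C (Dom C i) \<or> iso_arrow C i)"


section \<open>Complex-linear semisimple abelian categories\<close>

record ('o, 'm) linear_data = "('o, 'm) category_data" +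
  zero_arr :: "'o \<Rightarrow> 'o \<Rightarrow> 'm"
  add_arr :: "'m \<Rightarrow> 'm \<Rightarrow> 'm" (infixl \<open>\<^bold>+\<index>\<close> 60)
  scale_arr :: "complex \<Rightarrow> 'm \<Rightarrow> 'm" (infixr \<open>\<^bold>*\<index>\<close> 75)

text \<open>
  The space of arrows between two objects, as a module record over the ring record of the
  complex numbers.  The multiplicative fields of the record play no role in the \<^locale>\<open>module\<close>
  axioms and are left undefined.
\<close>

definition hom_space ::
  "('o, 'm, 'z) linear_data_scheme \<Rightarrow> 'o \<Rightarrow> 'o \<Rightarrow> (complex, 'm) module" where
  "hom_space C a b =
    \<lparr>carrier = Hom C a b, monoid.mult = undefined, one = undefined,
     ring.zero = zero_arr C a b, ring.add = add_arr C, module.smult = scale_arr C\<rparr>"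

definition finite_dim_hom :: "('o, 'm, 'z) linear_data_scheme \<Rightarrow> 'o \<Rightarrow> 'o \<Rightarrow> bool" where
  "finite_dim_hom C a b \<longleftrightarrow>
    (\<exists>B. finite B \<and> B \<subseteq> Hom C a b \<and>
      (\<forall>f \<in> Hom C a b. \<exists>c. f = finsum (hom_space C a b) (\<lambda>e. scale_arr C (c e) e) B))"

locale linear_category = category C
  for C :: "('o, 'm, 'z) linear_data_scheme" (structure) +
  assumes hom_vector_space:
      "\<lbrakk>a \<in> Obj C; b \<in> Obj C\<rbrakk> \<Longrightarrow>
        Module.module (ring_of_type_algebra :: complex ring) (hom_space C a b)"
    and comp_add_right:
      "\<lbrakk>f \<in> Hom C a b; f' \<in> Hom C a b; g \<in> Hom C b c\<rbrakk> \<Longrightarrow> g \<cdot> (f \<^bold>+ f') = g \<cdot> f \<^bold>+ g \<cdot> f'"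
    and comp_add_left:
      "\<lbrakk>f \<in> Hom C a b; g \<in> Hom C b c; g' \<in> Hom C b c\<rbrakk> \<Longrightarrow> (g \<^bold>+ g') \<cdot> f = g \<cdot> f \<^bold>+ g' \<cdot> f"
    and comp_scale_right:
      "\<lbrakk>f \<in> Hom C a b; g \<in> Hom C b c\<rbrakk> \<Longrightarrow> g \<cdot> (t \<^bold>* f) = t \<^bold>* (g \<cdot> f)"
    and comp_scale_left:
      "\<lbrakk>f \<in> Hom C a b; g \<in> Hom C b c\<rbrakk> \<Longrightarrow> (t \<^bold>* g) \<cdot> f = t \<^bold>* (g \<cdot> f)"

text \<open>
  \<open>x\<close> is a direct sum (biproduct) of the finite family \<open>as\<close>.  For the empty list this says that
  \<open>x\<close> is a zero object.
\<close>

definition direct_sum :: "('o, 'm, 'z) linear_data_scheme \<Rightarrow> 'o \<Rightarrow> 'o list \<Rightarrow> bool" where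
  "direct_sum C x as \<longleftrightarrow> x \<in> Obj C \<and> set as \<subseteq> Obj C \<and>
    (\<exists>\<iota> \<pi>.
      (\<forall>i < length as. \<iota> i \<in> Hom C (as ! i) x \<and> \<pi> i \<in> Hom C x (as ! i)) \<and>
      (\<forall>i < length as. \<forall>j < length as.
        \<pi> j \<cdot> \<iota> i = (if i = j then \<ii> (as ! i) else zero_arr C (as ! i) (as ! j))) \<and>
      finsum (hom_space C x x) (\<lambda>i. \<iota> i \<cdot> \<pi> i) {..<length as} = \<ii> x)"
  for C (structure)

definition is_kernel :: "('o, 'm, 'z) linear_data_scheme \<Rightarrow> 'm \<Rightarrow> 'm \<Rightarrow> bool" where
  "is_kernel C k f \<longleftrightarrow>
    f \<in> Arr C \<and> k \<in> Arr C \<and> Cod C k = Dom C f \<and>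
    f \<cdot> k = zero_arr C (Dom C k) (Cod C f) \<and>
    (\<forall>a \<in> Obj C. \<forall>g \<in> Hom C a (Dom C f). f \<cdot> g = zero_arr C a (Cod C f) \<longrightarrow>
      (\<exists>!u. u \<in> Hom C a (Dom C k) \<and> k \<cdot> u = g))"
  for C (structure)

definition is_cokernel :: "('o, 'm, 'z) linear_data_scheme \<Rightarrow> 'm \<Rightarrow> 'm \<Rightarrow> bool" where
  "is_cokernel C q f \<longleftrightarrow>
    f \<in> Arr C \<and> q \<in> Arr C \<and> Dom C q = Cod C f \<and>
    q \<cdot> f = zero_arr C (Dom C f) (Cod C q) \<and>
    (\<forall>a \<in> Obj C. \<forall>g \<in> Hom C (Cod C f) a. g \<cdot> f = zero_arr C (Dom C f) a \<longrightarrow>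
      (\<exists>!u. u \<in> Hom C (Cod C q) a \<and> u \<cdot> q = g))"
  for C (structure)

locale abelian_category = linear_category C
  for C :: "('o, 'm, 'z) linear_data_scheme" (structure) +
  assumes has_direct_sums: "set as \<subseteq> Obj C \<Longrightarrow> \<exists>x. direct_sum C x as"
    and has_kernels: "f \<in> Arr C \<Longrightarrow> \<exists>k. is_kernel C k f"
    and has_cokernels: "f \<in> Arr C \<Longrightarrow> \<exists>q. is_cokernel C q f"
    and monos_are_kernels: "mono_arrow C f \<Longrightarrow> \<exists>g. is_kernel C f g"
    and epis_are_cokernels: "epi_arrow C f \<Longrightarrow> \<exists>g. is_cokernel C f g"

definition simple_decomposition ::
  "('o, 'm, 'z) linear_data_scheme \<Rightarrow> 'o \<Rightarrow> 'o list \<Rightarrow> bool" where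
  "simple_decomposition C x ss \<longleftrightarrow> (\<forall>s \<in> set ss. simple_object C s) \<and> direct_sum C x ss"

definition iso_class :: "('o, 'm, 'z) category_data_scheme \<Rightarrow> 'o \<Rightarrow> 'o set" where
  "iso_class C a = {b \<in> Obj C. isomorphic C a b}"

definition simple_classes :: "('o, 'm, 'z) category_data_scheme \<Rightarrow> 'o set set" where
  "simple_classes C = iso_class C ` {s. simple_object C s}"


section \<open>Fusion categories\<close>

record ('o, 'm) tensor_data = "('o, 'm) linear_data" +
  tensor_obj :: "'o \<Rightarrow> 'o \<Rightarrow> 'o" (infixl \<open>\<boxdot>\<index>\<close> 70)
  tensor_arr :: "'m \<Rightarrow> 'm \<Rightarrow> 'm" (infixl \<open>\<boxtimes>\<index>\<close> 70)
  unit_obj :: "'o" (\<open>\<I>\<index>\<close>)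
  associator :: "'o \<Rightarrow> 'o \<Rightarrow> 'o \<Rightarrow> 'm" (\<open>\<a>\<index>\<close>)
  left_unitor :: "'o \<Rightarrow> 'm" (\<open>\<l>\<index>\<close>)
  right_unitor :: "'o \<Rightarrow> 'm" (\<open>\<r>\<index>\<close>)

locale tensor_category = linear_category C
  for C :: "('o, 'm, 'z) tensor_data_scheme" (structure) +
  assumes tensor_obj_closed: "\<lbrakk>a \<in> Obj C; b \<in> Obj C\<rbrakk> \<Longrightarrow> a \<boxdot> b \<in> Obj C"
    and tensor_arr_closed:
      "\<lbrakk>f \<in> Hom C a b; g \<in> Hom C c d\<rbrakk> \<Longrightarrow> f \<boxtimes> g \<in> Hom C (a \<boxdot> c) (b \<boxdot> d)"
    and tensor_id: "\<lbrakk>a \<in> Obj C; b \<in> Obj C\<rbrakk> \<Longrightarrow> \<ii> a \<boxtimes> \<ii> b = \<ii> (a \<boxdot> b)"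
    and tensor_comp:
      "\<lbrakk>f \<in> Hom C a b; g \<in> Hom C b c; f' \<in> Hom C a' b'; g' \<in> Hom C b' c'\<rbrakk> \<Longrightarrow>
        (g \<cdot> f) \<boxtimes> (g' \<cdot> f') = (g \<boxtimes> g') \<cdot> (f \<boxtimes> f')"
    and tensor_add_left:
      "\<lbrakk>f \<in> Hom C a b; f' \<in> Hom C a b; g \<in> Hom C c d\<rbrakk> \<Longrightarrow>
        (f \<^bold>+ f') \<boxtimes> g = (f \<boxtimes> g) \<^bold>+ (f' \<boxtimes> g)"
    and tensor_add_right:
      "\<lbrakk>f \<in> Hom C a b; g \<in> Hom C c d; g' \<in> Hom C c d\<rbrakk> \<Longrightarrow>
        f \<boxtimes> (g \<^bold>+ g') = (f \<boxtimes> g) \<^bold>+ (f \<boxtimes> g')"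
    and tensor_scale_left:
      "\<lbrakk>f \<in> Hom C a b; g \<in> Hom C c d\<rbrakk> \<Longrightarrow> (t \<^bold>* f) \<boxtimes> g = t \<^bold>* (f \<boxtimes> g)"
    and tensor_scale_right:
      "\<lbrakk>f \<in> Hom C a b; g \<in> Hom C c d\<rbrakk> \<Longrightarrow> f \<boxtimes> (t \<^bold>* g) = t \<^bold>* (f \<boxtimes> g)"
    and unit_closed: "\<I> \<in> Obj C"
    and associator_closed:
      "\<lbrakk>a \<in> Obj C; b \<in> Obj C; c \<in> Obj C\<rbrakk> \<Longrightarrow>
        \<a> a b c \<in> Hom C ((a \<boxdot> b) \<boxdot> c) (a \<boxdot> (b \<boxdot> c))"
    and associator_iso:
      "\<lbrakk>a \<in> Obj C; b \<in> Obj C; c \<in> Obj C\<rbrakk> \<Longrightarrow> iso_arrow C (\<a> a b c)"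
    and associator_natural:
      "\<lbrakk>f \<in> Hom C a a'; g \<in> Hom C b b'; h \<in> Hom C c c'\<rbrakk> \<Longrightarrow>
        \<a> a' b' c' \<cdot> ((f \<boxtimes> g) \<boxtimes> h) = (f \<boxtimes> (g \<boxtimes> h)) \<cdot> \<a> a b c"
    and left_unitor_closed: "a \<in> Obj C \<Longrightarrow> \<l> a \<in> Hom C (\<I> \<boxdot> a) a"
    and left_unitor_iso: "a \<in> Obj C \<Longrightarrow> iso_arrow C (\<l> a)"
    and left_unitor_natural: "f \<in> Hom C a b \<Longrightarrow> \<l> b \<cdot> (\<ii> \<I> \<boxtimes> f) = f \<cdot> \<l> a"
    and right_unitor_closed: "a \<in> Obj C \<Longrightarrow> \<r> a \<in> Hom C (a \<boxdot> \<I>) a"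
    and right_unitor_iso: "a \<in> Obj C \<Longrightarrow> iso_arrow C (\<r> a)"
    and right_unitor_natural: "f \<in> Hom C a b \<Longrightarrow> \<r> b \<cdot> (f \<boxtimes> \<ii> \<I>) = f \<cdot> \<r> a"
    and pentagon:
      "\<lbrakk>a \<in> Obj C; b \<in> Obj C; c \<in> Obj C; d \<in> Obj C\<rbrakk> \<Longrightarrow>
        \<a> a b (c \<boxdot> d) \<cdot> \<a> (a \<boxdot> b) c d =
        (\<ii> a \<boxtimes> \<a> b c d) \<cdot> \<a> a (b \<boxdot> c) d \<cdot> (\<a> a b c \<boxtimes> \<ii> d)"
    and triangle:
      "\<lbrakk>a \<in> Obj C; b \<in> Obj C\<rbrakk> \<Longrightarrow> (\<ii> a \<boxtimes> \<l> b) \<cdot> \<a> a \<I> b = \<r> a \<boxtimes> \<ii> b"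

text \<open>
  \<open>y\<close> is a left dual of \<open>x\<close>, with evaluation \<open>y \<boxdot> x \<rightarrow> \<I>\<close> and coevaluation
  \<open>\<I> \<rightarrow> x \<boxdot> y\<close>; equivalently \<open>x\<close> is a right dual of \<open>y\<close>.
\<close>

definition left_dual :: "('o, 'm, 'z) tensor_data_scheme \<Rightarrow> 'o \<Rightarrow> 'o \<Rightarrow> bool" where
  "left_dual C x y \<longleftrightarrow> x \<in> Obj C \<and> y \<in> Obj C \<and>
    (\<exists>ev \<in> Hom C (y \<boxdot> x) \<I>. \<exists>coev \<in> Hom C \<I> (x \<boxdot> y).
      \<r> x \<cdot> (\<ii> x \<boxtimes> ev) \<cdot> \<a> x y x \<cdot> (coev \<boxtimes> \<ii> x) \<cdot> inv_arrow C (\<l> x) = \<ii> x \<and>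
      \<l> y \<cdot> (ev \<boxtimes> \<ii> y) \<cdot> inv_arrow C (\<a> y x y) \<cdot> (\<ii> y \<boxtimes> coev) \<cdot> inv_arrow C (\<r> y) = \<ii> y)"
  for C (structure)

locale fusion_category = abelian_category C + tensor_category C
  for C :: "('o, 'm, 'z) tensor_data_scheme" (structure) +
  assumes finite_dim_homs: "\<lbrakk>a \<in> Obj C; b \<in> Obj C\<rbrakk> \<Longrightarrow> finite_dim_hom C a b"
    and semisimple: "x \<in> Obj C \<Longrightarrow> \<exists>ss. simple_decomposition C x ss"
    and finitely_many_simples: "finite (simple_classes C)"
    and has_left_duals: "x \<in> Obj C \<Longrightarrow> \<exists>y. left_dual C x y"
    and has_right_duals: "x \<in> Obj C \<Longrightarrow> \<exists>y. left_dual C y x"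
    and unit_simple: "simple_object C \<I>"


section \<open>Based rings and Grothendieck rings\<close>

record 'a based_ring = "'a ring" +
  basis :: "'a set"

text \<open>
  The free abelian group on a set \<open>B\<close>, with multiplication the bilinear extension of a product
  \<open>p\<close> of basis elements, and unit the basis element \<open>e\<close>.
\<close>

definition free_based_ring ::
  "'b set \<Rightarrow> 'b \<Rightarrow> ('b \<Rightarrow> 'b \<Rightarrow> 'b \<Rightarrow>\<^sub>0 int) \<Rightarrow> ('b \<Rightarrow>\<^sub>0 int) based_ring" where
  "free_based_ring B e p =
    \<lparr>carrier = {x. Poly_Mapping.keys x \<subseteq> B},
     monoid.mult = (\<lambda>x y. frag_extend (\<lambda>i. frag_extend (p i) y) x),
     one = frag_of e, ring.zero = 0, ring.add = (+), basis = frag_of ` B\<rparr>"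

lemmas frag_induction_UNIV = frag_induction[where S=UNIV, OF subset_UNIV, case_names zero one diff]

lemma free_based_ring_cring:
  assumes u: "\<And>b. p e b = frag_of b" and c: "\<And>a b. p a b = p b a"
    and a: "\<And>a b c. frag_extend (\<lambda>i. p i c) (p a b) = frag_extend (p a) (p b c)"
  shows "cring (free_based_ring UNIV e p)"
proof -
  let ?m = "\<lambda>x y. frag_extend (\<lambda>i. frag_extend (p i) y) x"
  have ar: "?m x (y+z) = ?m x y + ?m x z" for x y z
    by (induction x rule: frag_induction_UNIV) (auto simp: frag_extend_add frag_extend_diff algebra_simps)
  have al: "?m (x+y) z = ?m x z + ?m y z" for x y z by (simp add: frag_extend_add)
  have dl: "?m (x-y) z = ?m x z - ?m y z" for x y z by (simp add: frag_extend_diff)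
  have dr: "?m x (y-z) = ?m x y - ?m x z" for x y z
    using ar[where x=x and y="y-z" and z=z] by simp
  have com1: "?m (frag_of b) y = ?m y (frag_of b)" for b y
    by (induction y rule: frag_induction_UNIV) (auto simp: frag_extend_diff c)
  have z2: "?m x 0 = 0" for x using dr[where x=x and y=0 and z=0] by simp
  have com: "?m x y = ?m y x" for x y
  proof (induction x rule: frag_induction_UNIV)
    case zero show ?case using z2[where x=y] by simp
  next case (one a) show ?case by (rule com1)
  next case (diff a b) then show ?case by (simp only: dl dr)
  qed
  have ass0: "?m (p i j) y = frag_extend (p i) (?m (frag_of j) y)" for i j y
  proof (induction y rule: frag_induction_UNIV)
    case zero show ?case using z2[where x="p i j"] by simp
  next case (one b) show ?case by (simp add: a)
  next case (diff a b) then show ?case using dr[where x="p i j" and y=a and z=b] by (simp add: frag_extend_diff)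
  qed
  have ass1: "?m (frag_extend (p i) y) z = frag_extend (p i) (?m y z)" for i y z
    by (induction y rule: frag_induction_UNIV) (use ass0 in \<open>auto simp: frag_extend_diff\<close>)
  have ass: "?m (?m x y) z = ?m x (?m y z)" for x y z
    by (induction x rule: frag_induction_UNIV) (use ass1 in \<open>auto simp: frag_extend_diff\<close>)
  have "p e = frag_of" using u by auto
  then have one: "?m (frag_of e) x = x" for x
    using frag_expansion[of x] by simp
  show ?thesis
    apply (rule cringI)
    subgoal by (rule abelian_groupI) (auto simp: free_based_ring_def add_ac intro: exI[of _ "- x" for x])
    subgoal by (rule comm_monoidI) (simp_all add: free_based_ring_def, rule ass, use one in simp, rule com)
    subgoal using al by (simp add: free_based_ring_def)
    done
qed

definition based_ring_isomorphic ::
  "('a, 'y) based_ring_scheme \<Rightarrow> ('b, 'z) based_ring_scheme \<Rightarrow> bool" where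
  "based_ring_isomorphic R S \<longleftrightarrow> (\<exists>h \<in> ring_iso R S. h ` basis R = basis S)"

text \<open>
  The number of summands of \<open>x\<close> in the isomorphism class \<open>K\<close> of simple objects; by the
  Krull-Schmidt theorem it does not depend on the chosen decomposition.
\<close>

definition multiplicity_in :: "('o, 'm, 'z) linear_data_scheme \<Rightarrow> 'o \<Rightarrow> 'o set \<Rightarrow> nat" where
  "multiplicity_in C x K =
    (THE n. \<exists>ss. simple_decomposition C x ss \<and> n = length (filter (\<lambda>s. s \<in> K) ss))"

definition grothendieck_class ::
  "('o, 'm, 'z) linear_data_scheme \<Rightarrow> 'o \<Rightarrow> 'o set \<Rightarrow>\<^sub>0 int" where
  "grothendieck_class C x =
    (\<Sum>K \<in> simple_classes C. frag_cmul (int (multiplicity_in C x K)) (frag_of K))"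

text \<open>
  The product of two classes is the class of the tensor product of representatives; since the
  tensor product preserves isomorphisms, the choice of representatives does not matter.
\<close>

definition grothendieck_ring ::
  "('o, 'm, 'z) tensor_data_scheme \<Rightarrow> ('o set \<Rightarrow>\<^sub>0 int) based_ring" where
  "grothendieck_ring C =
    free_based_ring (simple_classes C) (iso_class C \<I>)
      (\<lambda>K L. grothendieck_class C ((SOME s. s \<in> K) \<boxdot> (SOME t. t \<in> L)))"
  for C (structure)


section \<open>The based rings $R_7$ and $R_8$\<close>

datatype basis_elt = B1 | BX | BY | BZ | BM | BN

text \<open>
  The products common to both rings; \<open>sq\<close> is the value of \<open>M\<^sup>2 = N\<^sup>2\<close> and \<open>mn\<close> that of
  \<open>MN = NM\<close>.
\<close>

fun basis_product ::
  "(basis_elt \<Rightarrow>\<^sub>0 int) \<Rightarrow> (basis_elt \<Rightarrow>\<^sub>0 int) \<Rightarrow> basis_elt \<Rightarrow> basis_elt \<Rightarrow> basis_elt \<Rightarrow>\<^sub>0 int" where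
  "basis_product sq mn B1 b = frag_of b"
| "basis_product sq mn b B1 = frag_of b"
| "basis_product sq mn BX BX = frag_of BY"
| "basis_product sq mn BX BY = frag_of B1"
| "basis_product sq mn BY BX = frag_of B1"
| "basis_product sq mn BY BY = frag_of BX"
| "basis_product sq mn BX BZ = frag_of BZ"
| "basis_product sq mn BZ BX = frag_of BZ"
| "basis_product sq mn BY BZ = frag_of BZ"
| "basis_product sq mn BZ BY = frag_of BZ"
| "basis_product sq mn BZ BZ = frag_of B1 + frag_of BX + frag_of BY + frag_cmul 2 (frag_of BZ)"
| "basis_product sq mn BX BM = frag_of BM"
| "basis_product sq mn BM BX = frag_of BM"
| "basis_product sq mn BY BM = frag_of BM"
| "basis_product sq mn BM BY = frag_of BM"
| "basis_product sq mn BX BN = frag_of BN"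
| "basis_product sq mn BN BX = frag_of BN"
| "basis_product sq mn BY BN = frag_of BN"
| "basis_product sq mn BN BY = frag_of BN"
| "basis_product sq mn BZ BM = frag_of BM + frag_cmul 2 (frag_of BN)"
| "basis_product sq mn BM BZ = frag_of BM + frag_cmul 2 (frag_of BN)"
| "basis_product sq mn BZ BN = frag_cmul 2 (frag_of BM) + frag_of BN"
| "basis_product sq mn BN BZ = frag_cmul 2 (frag_of BM) + frag_of BN"
| "basis_product sq mn BM BM = sq"
| "basis_product sq mn BN BN = sq"
| "basis_product sq mn BM BN = mn"
| "basis_product sq mn BN BM = mn"

definition R7 :: "(basis_elt \<Rightarrow>\<^sub>0 int) based_ring" where
  "R7 = free_based_ring UNIV B1
    (basis_product
      (frag_of B1 + frag_of BX + frag_of BY + frag_of BZ)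
      (frag_cmul 2 (frag_of BZ)))"

definition R8 :: "(basis_elt \<Rightarrow>\<^sub>0 int) based_ring" where
  "R8 = free_based_ring UNIV B1
    (basis_product
      (frag_cmul 2 (frag_of BZ))
      (frag_of B1 + frag_of BX + frag_of BY + frag_of BZ))"

lemma R7_cring: "cring R7" unfolding R7_def
  apply (rule free_based_ring_cring)
  subgoal by simp
  subgoal for a b by (cases a; cases b; simp)
  subgoal for a b c by (cases a; cases b; cases c; simp add: frag_extend_add frag_extend_cmul frag_cmul_distrib2; 
     (rule poly_mapping_eqI; simp add: lookup_add; fail)?)
  done

lemma R8_cring: "cring R8" unfolding R8_def
  apply (rule free_based_ring_cring)
  subgoal by simp
  subgoal for a b by (cases a; cases b; simp)
  subgoal for a b c by (cases a; cases b; cases c; simp add: frag_extend_add frag_extend_cmul frag_cmul_distrib2; 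
     (rule poly_mapping_eqI; simp add: lookup_add; fail)?)
  done

end

theory Submission
  imports Defs "HOL-Computational_Algebra.Fundamental_Theorem_Algebra"
begin

text \<open>
  Write \<open>P, Q\<close> for the pair \<open>M, M\<close> in the first ring and \<open>M, N\<close> in the second.  In both cases
  \<open>P Q = Q P = 1 + X + Y + Z\<close>, the invertible object \<open>X\<close> of order three is absorbed by \<open>P\<close> and \<open>Q\<close>,
  and \<open>X Z = Z\<close>.  These rules alone are contradictory (\<open>no_compatible_fusion_rules\<close>).

  Isomorphisms \<open>f: P \<rightarrow> P X\<close> and \<open>g: X Q \<rightarrow> Q\<close> define an endomorphism \<open>T\<close> of \<open>P Q\<close>, the
  \<open>middle_twist\<close>: it creates an \<open>X\<close> out of \<open>P\<close> and lets \<open>Q\<close> absorb it.  The fusion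
  rules make \<open>1, T, T\<^sup>2\<close> both linearly dependent and linearly independent.

  They are dependent.  As \<open>P Q\<close> is multiplicity free, \<open>T\<close> acts by a scalar \<open>t\<^sub>s\<close> on the summand \<open>s\<close>
  (\<open>isotypic_eigenvalue\<close>).  An isomorphism \<open>P \<rightarrow> X P\<close> identifies \<open>P Q\<close> with \<open>X (P Q)\<close>, and there it
  commutes with \<open>T\<close> up to the scalar \<open>b\<close> by which the left and the right action of \<open>X\<close> on \<open>P\<close> fail to
  commute (\<open>middle_twist_left_action\<close>).  Hence \<open>t\<^sub>r = b t\<^sub>s\<close> whenever \<open>X s\<close> is isomorphic to \<open>r\<close>.  The
  rule \<open>X Z = Z\<close> forces \<open>b = 1\<close>, and then \<open>t\<close> takes the same value on \<open>1\<close>, \<open>X\<close> and \<open>Y\<close>.  So \<open>T\<close> has at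
  most two eigenvalues and satisfies a quadratic equation.

  They are independent.  Tensoring with \<open>P\<close> on the right turns \<open>T\<close> into the middle twist \<open>S\<close> of
  \<open>P (Q P)\<close> (\<open>middle_twist_tensor\<close>).  Start from a nonzero \<open>j: 1 \<rightarrow> Q P\<close>.  Then \<open>1\<close>, \<open>S\<close> and \<open>S\<^sup>2\<close> carry
  \<open>P 1\<close> into \<open>P (Q P)\<close> along nonzero arrows into \<open>Q P\<close> from \<open>1\<close>, \<open>X 1\<close> and \<open>X (X 1)\<close>, preceded by
  isomorphisms (\<open>middle_twist_whisker\<close>).  These three objects are simple, and the last is isomorphic to
  neither of the others, so a projection of \<open>Q P\<close> that detects it kills the quadratic relation except for
  its leading term, which becomes an isomorphism equal to zero.

  Underneath lie Schur's lemma, including that endomorphisms of a simple object are complex scalars, and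
  the uniqueness of multiplicities, which makes the structure constants of the Grothendieck ring into
  statements about decompositions of tensor products.
\<close>

section \<open>Calculus of arrows in a linear category\<close>

context category
begin

text \<open>
  The axioms are restated through \<open>Arr\<close>, \<open>Dom\<close> and \<open>Cod\<close>: the intermediate object of a composite is then
  computed by simplification instead of being guessed by unification.
\<close>

lemma Hom_iff: "f \<in> Hom C a b \<longleftrightarrow> f \<in> Arr C \<and> Dom C f = a \<and> Cod C f = b"
  by (simp add: Hom_def)

lemma Dom_obj [simp]: "f \<in> Arr C \<Longrightarrow> Dom C f \<in> Obj C"
  by (rule dom_closed)

lemma Cod_obj [simp]: "f \<in> Arr C \<Longrightarrow> Cod C f \<in> Obj C"
  by (rule cod_closed)

lemma arr_id [simp]:
  assumes "a \<in> Obj C"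
  shows "\<ii> a \<in> Arr C" "Dom C (\<ii> a) = a" "Cod C (\<ii> a) = a"
  using id_closed[OF assms] by (simp_all add: Hom_iff)

lemma arr_comp [simp]:
  assumes "f \<in> Arr C" "g \<in> Arr C" "Dom C g = Cod C f"
  shows "g \<cdot> f \<in> Arr C" "Dom C (g \<cdot> f) = Dom C f" "Cod C (g \<cdot> f) = Cod C g"
  using comp_closed[of f "Dom C f" "Cod C f" g "Cod C g"] assms by (simp_all add: Hom_iff)

lemma comp_id [simp]:
  "f \<in> Arr C \<Longrightarrow> Dom C f = a \<Longrightarrow> f \<cdot> \<ii> a = f"
  "f \<in> Arr C \<Longrightarrow> Cod C f = a \<Longrightarrow> \<ii> a \<cdot> f = f"
  by (auto intro: comp_id_left comp_id_right simp: Hom_iff)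

lemma assoc:
  "\<lbrakk>f \<in> Arr C; g \<in> Arr C; h \<in> Arr C; Dom C g = Cod C f; Dom C h = Cod C g\<rbrakk> \<Longrightarrow>
    h \<cdot> g \<cdot> f = h \<cdot> (g \<cdot> f)"
  using comp_assoc[of f "Dom C f" "Cod C f" g "Cod C g" h "Cod C h"] by (simp add: Hom_iff)

lemma iso_arrowE:
  assumes "iso_arrow C f"
  obtains g where "f \<in> Arr C" "g \<in> Arr C" "Dom C g = Cod C f" "Cod C g = Dom C f"
    "g \<cdot> f = \<ii> (Dom C f)" "f \<cdot> g = \<ii> (Cod C f)"
  using assms by (auto simp: iso_arrow_def inverse_arrows_def Hom_iff)

lemma iso_arrowI:
  assumes "f \<in> Arr C" "g \<in> Arr C" "Dom C g = Cod C f" "Cod C g = Dom C f"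
    "g \<cdot> f = \<ii> (Dom C f)" "f \<cdot> g = \<ii> (Cod C f)"
  shows "iso_arrow C f"
  using assms by (auto simp: iso_arrow_def inverse_arrows_def Hom_iff)

lemma iso_arrow_arr: "iso_arrow C f \<Longrightarrow> f \<in> Arr C"
  by (auto elim: iso_arrowE)

lemma iso_arrow_id: "a \<in> Obj C \<Longrightarrow> iso_arrow C (\<ii> a)"
  by (rule iso_arrowI[where g = "\<ii> a"]) auto

lemma iso_arrow_comp:
  assumes f: "iso_arrow C f" and g: "iso_arrow C g" and D: "Dom C g = Cod C f"
  shows "iso_arrow C (g \<cdot> f)"
proof -
  obtain f' where f': "f \<in> Arr C" "f' \<in> Arr C" "Dom C f' = Cod C f" "Cod C f' = Dom C f"
    "f' \<cdot> f = \<ii> (Dom C f)" "f \<cdot> f' = \<ii> (Cod C f)" using f by (rule iso_arrowE)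
  obtain g' where g': "g \<in> Arr C" "g' \<in> Arr C" "Dom C g' = Cod C g" "Cod C g' = Dom C g"
    "g' \<cdot> g = \<ii> (Dom C g)" "g \<cdot> g' = \<ii> (Cod C g)" using g by (rule iso_arrowE)
  have "f' \<cdot> g' \<cdot> (g \<cdot> f) = f' \<cdot> (g' \<cdot> g \<cdot> f)"
    using f'(1-4) g'(1-4) D by (simp add: assoc)
  also have "\<dots> = \<ii> (Dom C f)" using f' g' D by simp
  finally have 1: "f' \<cdot> g' \<cdot> (g \<cdot> f) = \<ii> (Dom C f)" .
  have "g \<cdot> f \<cdot> (f' \<cdot> g') = g \<cdot> (f \<cdot> f' \<cdot> g')"
    using f'(1-4) g'(1-4) D by (simp add: assoc)
  also have "\<dots> = \<ii> (Cod C g)" using f' g' D by simp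
  finally have 2: "g \<cdot> f \<cdot> (f' \<cdot> g') = \<ii> (Cod C g)" .
  show ?thesis
    by (rule iso_arrowI[where g = "f' \<cdot> g'"]) (use f'(1-4) g'(1-4) D 1 2 in auto)
qed

lemma isomorphicI: "iso_arrow C f \<Longrightarrow> Dom C f = a \<Longrightarrow> Cod C f = b \<Longrightarrow> isomorphic C a b"
  using iso_arrow_arr[of f] by (auto simp: isomorphic_def Hom_iff)

lemma isomorphicE:
  assumes "isomorphic C a b"
  obtains f where "iso_arrow C f" "f \<in> Arr C" "Dom C f = a" "Cod C f = b"
  using assms by (auto simp: isomorphic_def Hom_iff)

lemma isomorphic_obj: "isomorphic C a b \<Longrightarrow> a \<in> Obj C \<and> b \<in> Obj C"
  by (auto elim: isomorphicE)

lemma isomorphic_refl: "a \<in> Obj C \<Longrightarrow> isomorphic C a a"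
  by (rule isomorphicI[OF iso_arrow_id]) auto

lemma isomorphic_sym:
  assumes "isomorphic C a b"
  shows "isomorphic C b a"
proof -
  obtain f where f: "iso_arrow C f" "Dom C f = a" "Cod C f = b"
    using assms by (rule isomorphicE)
  obtain g where g: "f \<in> Arr C" "g \<in> Arr C" "Dom C g = Cod C f" "Cod C g = Dom C f"
    "g \<cdot> f = \<ii> (Dom C f)" "f \<cdot> g = \<ii> (Cod C f)" using f(1) by (rule iso_arrowE)
  have "iso_arrow C g" by (rule iso_arrowI[where g = f]) (use g in auto)
  then show ?thesis using f g by (auto intro: isomorphicI)
qed

lemma isomorphic_trans:
  assumes "isomorphic C a b" "isomorphic C b c"
  shows "isomorphic C a c"
proof -
  obtain f g where "iso_arrow C f" "f \<in> Arr C" "Dom C f = a" "Cod C f = b"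
    "iso_arrow C g" "g \<in> Arr C" "Dom C g = b" "Cod C g = c"
    using assms by (meson isomorphicE)
  then show ?thesis by (intro isomorphicI[of "g \<cdot> f"] iso_arrow_comp) simp_all
qed

lemma iso_class_eq_iff:
  assumes "a \<in> Obj C" "b \<in> Obj C"
  shows "iso_class C a = iso_class C b \<longleftrightarrow> isomorphic C a b"
proof
  assume "iso_class C a = iso_class C b"
  moreover have "b \<in> iso_class C b" using assms isomorphic_refl by (simp add: iso_class_def)
  ultimately show "isomorphic C a b" by (auto simp: iso_class_def)
next
  assume "isomorphic C a b"
  then show "iso_class C a = iso_class C b"
    by (auto simp: iso_class_def intro: isomorphic_trans isomorphic_sym)
qed

end

context linear_category
begin

lemma hom_space_simps [simp]:
  "carrier (hom_space C a b) = Hom C a b"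
  "ring.add (hom_space C a b) f g = f \<^bold>+ g"
  "ring.zero (hom_space C a b) = zero_arr C a b"
  "module.smult (hom_space C a b) t f = t \<^bold>* f"
  by (simp_all add: hom_space_def)

lemma complex_ring_simps [simp]:
  "carrier (ring_of_type_algebra :: complex ring) = UNIV"
  "ring.add (ring_of_type_algebra :: complex ring) s t = s + t"
  "monoid.mult (ring_of_type_algebra :: complex ring) s t = s * t"
  "monoid.one (ring_of_type_algebra :: complex ring) = 1"
  "ring.zero (ring_of_type_algebra :: complex ring) = 0"
  by (simp_all add: ring_of_type_algebra_def)

lemma arr_zero [simp]:
  assumes "a \<in> Obj C" "b \<in> Obj C"
  shows "zero_arr C a b \<in> Arr C" "Dom C (zero_arr C a b) = a" "Cod C (zero_arr C a b) = b"
proof -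
  interpret M: Module.module "ring_of_type_algebra :: complex ring" "hom_space C a b"
    using assms by (rule hom_vector_space)
  show "zero_arr C a b \<in> Arr C" "Dom C (zero_arr C a b) = a" "Cod C (zero_arr C a b) = b"
    using M.M.zero_closed by (simp_all add: Hom_iff)
qed

lemma arr_add [simp]:
  assumes "f \<in> Arr C" "g \<in> Arr C" "Dom C g = Dom C f" "Cod C g = Cod C f"
  shows "f \<^bold>+ g \<in> Arr C" "Dom C (f \<^bold>+ g) = Dom C f" "Cod C (f \<^bold>+ g) = Cod C f"
proof -
  interpret M: Module.module "ring_of_type_algebra :: complex ring" "hom_space C (Dom C f) (Cod C f)"
    by (rule hom_vector_space) (use assms in auto)
  show "f \<^bold>+ g \<in> Arr C" "Dom C (f \<^bold>+ g) = Dom C f" "Cod C (f \<^bold>+ g) = Cod C f"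
    using M.M.add.m_closed[of f g] assms by (simp_all add: Hom_iff)
qed

lemma arr_scale [simp]:
  assumes "f \<in> Arr C"
  shows "t \<^bold>* f \<in> Arr C" "Dom C (t \<^bold>* f) = Dom C f" "Cod C (t \<^bold>* f) = Cod C f"
proof -
  interpret M: Module.module "ring_of_type_algebra :: complex ring" "hom_space C (Dom C f) (Cod C f)"
    by (rule hom_vector_space) (use assms in auto)
  show "t \<^bold>* f \<in> Arr C" "Dom C (t \<^bold>* f) = Dom C f" "Cod C (t \<^bold>* f) = Cod C f"
    using M.smult_closed[of t f] assms by (simp_all add: Hom_iff)
qed

lemma scale_laws:
  assumes "f \<in> Arr C"
  shows scale_one [simp]: "1 \<^bold>* f = f"
    and scale_scale [simp]: "s \<^bold>* t \<^bold>* f = (s * t) \<^bold>* f"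
    and scale_add_left: "(s + t) \<^bold>* f = s \<^bold>* f \<^bold>+ t \<^bold>* f"
    and scale_zero_left [simp]: "0 \<^bold>* f = zero_arr C (Dom C f) (Cod C f)"
proof -
  interpret M: Module.module "ring_of_type_algebra :: complex ring" "hom_space C (Dom C f) (Cod C f)"
    by (rule hom_vector_space) (use assms in auto)
  have f: "f \<in> carrier (hom_space C (Dom C f) (Cod C f))" using assms by (simp add: Hom_iff)
  show "1 \<^bold>* f = f" using M.smult_one[OF f] by simp
  show "s \<^bold>* t \<^bold>* f = (s * t) \<^bold>* f" using M.smult_assoc1[of s t f] f by simp
  show "(s + t) \<^bold>* f = s \<^bold>* f \<^bold>+ t \<^bold>* f" using M.smult_l_distr[of s t f] f by simp
  show "0 \<^bold>* f = zero_arr C (Dom C f) (Cod C f)" using M.smult_l_null[OF f] by simp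
qed

lemma add_laws:
  assumes "f \<in> Arr C" "g \<in> Arr C" "Dom C g = Dom C f" "Cod C g = Cod C f"
  shows scale_add_right: "t \<^bold>* (f \<^bold>+ g) = t \<^bold>* f \<^bold>+ t \<^bold>* g"
    and add_commute: "f \<^bold>+ g = g \<^bold>+ f"
    and add_zero [simp]: "f \<^bold>+ zero_arr C (Dom C f) (Cod C f) = f"
      "zero_arr C (Dom C f) (Cod C f) \<^bold>+ f = f"
proof -
  interpret M: Module.module "ring_of_type_algebra :: complex ring" "hom_space C (Dom C f) (Cod C f)"
    by (rule hom_vector_space) (use assms in auto)
  have f: "f \<in> carrier (hom_space C (Dom C f) (Cod C f))"
    "g \<in> carrier (hom_space C (Dom C f) (Cod C f))" using assms by (simp_all add: Hom_iff)
  show "t \<^bold>* (f \<^bold>+ g) = t \<^bold>* f \<^bold>+ t \<^bold>* g" using M.smult_r_distr[of t f g] f by simp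
  show "f \<^bold>+ g = g \<^bold>+ f" using M.M.add.m_comm[of f g] f by simp
  show "f \<^bold>+ zero_arr C (Dom C f) (Cod C f) = f" "zero_arr C (Dom C f) (Cod C f) \<^bold>+ f = f"
    using M.M.add.r_one[of f] M.M.add.l_one[of f] f by simp_all
qed

lemma add_assoc:
  assumes "f \<in> Arr C" "g \<in> Arr C" "h \<in> Arr C" "Dom C g = Dom C f" "Cod C g = Cod C f"
    "Dom C h = Dom C f" "Cod C h = Cod C f"
  shows "f \<^bold>+ g \<^bold>+ h = f \<^bold>+ (g \<^bold>+ h)"
proof -
  interpret M: Module.module "ring_of_type_algebra :: complex ring" "hom_space C (Dom C f) (Cod C f)"
    by (rule hom_vector_space) (use assms in auto)
  show ?thesis using M.M.add.m_assoc[of f g h] assms by (simp add: Hom_iff)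
qed

lemma comp_scale [simp]:
  assumes "f \<in> Arr C" "g \<in> Arr C" "Dom C g = Cod C f"
  shows "g \<cdot> (t \<^bold>* f) = t \<^bold>* (g \<cdot> f)" "(t \<^bold>* g) \<cdot> f = t \<^bold>* (g \<cdot> f)"
  using comp_scale_right[of f "Dom C f" "Cod C f" g "Cod C g" t]
    comp_scale_left[of f "Dom C f" "Cod C f" g "Cod C g" t] assms by (simp_all add: Hom_iff)

lemma comp_add_distrib:
  "\<lbrakk>f \<in> Arr C; f' \<in> Arr C; g \<in> Arr C; Dom C g = Cod C f; Dom C f' = Dom C f; Cod C f' = Cod C f\<rbrakk>
    \<Longrightarrow> g \<cdot> (f \<^bold>+ f') = g \<cdot> f \<^bold>+ g \<cdot> f'"
  "\<lbrakk>f \<in> Arr C; g \<in> Arr C; g' \<in> Arr C; Dom C g = Cod C f; Dom C g' = Dom C g; Cod C g' = Cod C g\<rbrakk>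
    \<Longrightarrow> (g \<^bold>+ g') \<cdot> f = g \<cdot> f \<^bold>+ g' \<cdot> f"
  using comp_add_right[of f "Dom C f" "Cod C f" f' g "Cod C g"]
    comp_add_left[of f "Dom C f" "Cod C f" g "Cod C g" g'] by (simp_all add: Hom_iff)

lemma scale_zero_right [simp]:
  assumes "a \<in> Obj C" "b \<in> Obj C"
  shows "t \<^bold>* zero_arr C a b = zero_arr C a b"
proof -
  have "t \<^bold>* zero_arr C a b = t \<^bold>* 0 \<^bold>* zero_arr C a b"
    using assms by simp
  also have "\<dots> = zero_arr C a b" using assms by (subst scale_scale) simp_all
  finally show ?thesis .
qed

lemma comp_zero [simp]:
  assumes "f \<in> Arr C"
  shows "Dom C f = b \<Longrightarrow> a \<in> Obj C \<Longrightarrow> f \<cdot> zero_arr C a b = zero_arr C a (Cod C f)"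
    and "Cod C f = a \<Longrightarrow> b \<in> Obj C \<Longrightarrow> zero_arr C a b \<cdot> f = zero_arr C (Dom C f) b"
proof -
  assume h: "Dom C f = b" "a \<in> Obj C"
  then have b: "b \<in> Obj C" using assms by auto
  have "f \<cdot> zero_arr C a b = f \<cdot> (0 \<^bold>* zero_arr C a b)" using h b by simp
  also have "\<dots> = 0 \<^bold>* (f \<cdot> zero_arr C a b)" using h b assms by (subst comp_scale) simp_all
  finally show "f \<cdot> zero_arr C a b = zero_arr C a (Cod C f)" using h b assms by simp
next
  assume h: "Cod C f = a" "b \<in> Obj C"
  then have a: "a \<in> Obj C" using assms by auto
  have "zero_arr C a b \<cdot> f = 0 \<^bold>* zero_arr C a b \<cdot> f" using h a by simp
  also have "\<dots> = 0 \<^bold>* (zero_arr C a b \<cdot> f)" using h a assms by (subst comp_scale) simp_all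
  finally show "zero_arr C a b \<cdot> f = zero_arr C (Dom C f) b" using h a assms by simp
qed

text \<open>
  The additive inverse of an arrow \<open>g\<close> is written \<open>(-1) \<^bold>* g\<close>.
\<close>

lemma eq_if_diff_zero:
  assumes "f \<in> Arr C" "g \<in> Arr C" "Dom C g = Dom C f" "Cod C g = Cod C f"
    and "f \<^bold>+ (-1) \<^bold>* g = zero_arr C (Dom C f) (Cod C f)"
  shows "f = g"
proof -
  have inv: "(-1) \<^bold>* g \<^bold>+ g = zero_arr C (Dom C f) (Cod C f)"
    using scale_add_left[of g "-1" 1] assms by simp
  have "f = f \<^bold>+ ((-1) \<^bold>* g \<^bold>+ g)" using assms inv by simp
  also have "\<dots> = (f \<^bold>+ (-1) \<^bold>* g) \<^bold>+ g" using assms(1-4) by (simp add: add_assoc)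
  also have "\<dots> = zero_arr C (Dom C g) (Cod C g) \<^bold>+ g" using assms by simp
  also have "\<dots> = g" using assms(2) by (intro add_zero) simp_all
  finally show ?thesis .
qed

lemma scale_cancel:
  assumes "f \<in> Arr C" "s \<^bold>* f = t \<^bold>* f" "f \<noteq> zero_arr C (Dom C f) (Cod C f)"
  shows "s = t"
proof (rule ccontr)
  assume st: "s \<noteq> t"
  have "(s - t) \<^bold>* f = s \<^bold>* f \<^bold>+ (-t) \<^bold>* f"
    using scale_add_left[of f s "-t"] assms(1) by simp
  also have "\<dots> = (t + (- t)) \<^bold>* f" using assms by (simp only: scale_add_left)
  also have "\<dots> = zero_arr C (Dom C f) (Cod C f)" using assms by simp
  finally have "(1 / (s - t)) \<^bold>* (s - t) \<^bold>* f = zero_arr C (Dom C f) (Cod C f)"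
    using assms by simp
  moreover have "(1 / (s - t)) \<^bold>* (s - t) \<^bold>* f = f" using assms st by (subst scale_scale) simp_all
  ultimately show False using assms by simp
qed

lemma zero_object_iff: "zero_object C a \<longleftrightarrow> a \<in> Obj C \<and> \<ii> a = zero_arr C a a"
proof
  assume "zero_object C a"
  then have a: "a \<in> Obj C" and "\<exists>!f. f \<in> Hom C a a" by (auto simp: zero_object_def)
  moreover have "\<ii> a \<in> Hom C a a" "zero_arr C a a \<in> Hom C a a" using a by (simp_all add: Hom_iff)
  ultimately show "a \<in> Obj C \<and> \<ii> a = zero_arr C a a" by blast
next
  assume h: "a \<in> Obj C \<and> \<ii> a = zero_arr C a a"
  have "f = zero_arr C a b" if "f \<in> Hom C a b" for f b
    using comp_id(1)[of f a] that h by (simp add: Hom_iff)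
  moreover have "f = zero_arr C b a" if "f \<in> Hom C b a" for f b
    using comp_id(2)[of f a] that h by (simp add: Hom_iff)
  moreover have "zero_arr C a b \<in> Hom C a b" "zero_arr C b a \<in> Hom C b a" if "b \<in> Obj C" for b
    using h that by (simp_all add: Hom_iff)
  ultimately show "zero_object C a" using h unfolding zero_object_def by blast
qed

lemma iso_arrow_nonzero:
  assumes "iso_arrow C f" "\<not> zero_object C (Dom C f)"
  shows "f \<noteq> zero_arr C (Dom C f) (Cod C f)"
proof
  assume h: "f = zero_arr C (Dom C f) (Cod C f)"
  obtain g where g: "f \<in> Arr C" "g \<in> Arr C" "Dom C g = Cod C f" "Cod C g = Dom C f"
    "g \<cdot> f = \<ii> (Dom C f)" using assms(1) by (rule iso_arrowE)
  have "g \<cdot> f = zero_arr C (Dom C f) (Dom C f)" using comp_zero(1)[of g "Cod C f" "Dom C f"] h g by simp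
  then show False using g assms(2) zero_object_iff by simp
qed

lemma iso_comp_zero_cancel:
  assumes "iso_arrow C f" "g \<in> Arr C"
  shows "Dom C f = Cod C g \<Longrightarrow> f \<cdot> g = zero_arr C (Dom C g) (Cod C f) \<Longrightarrow>
      g = zero_arr C (Dom C g) (Cod C g)"
    and "Cod C f = Dom C g \<Longrightarrow> g \<cdot> f = zero_arr C (Dom C f) (Cod C g) \<Longrightarrow>
      g = zero_arr C (Dom C g) (Cod C g)"
proof -
  obtain k where k: "f \<in> Arr C" "k \<in> Arr C" "Dom C k = Cod C f" "Cod C k = Dom C f"
    "k \<cdot> f = \<ii> (Dom C f)" "f \<cdot> k = \<ii> (Cod C f)" using assms(1) by (rule iso_arrowE)
  show "g = zero_arr C (Dom C g) (Cod C g)"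
    if h: "Dom C f = Cod C g" "f \<cdot> g = zero_arr C (Dom C g) (Cod C f)"
  proof -
    have "g = k \<cdot> (f \<cdot> g)" using k h(1) assms(2) assoc[of g f k] by simp
    also have "\<dots> = zero_arr C (Dom C g) (Cod C g)" using h k assms(2) by simp
    finally show ?thesis .
  qed
  show "g = zero_arr C (Dom C g) (Cod C g)"
    if h: "Cod C f = Dom C g" "g \<cdot> f = zero_arr C (Dom C f) (Cod C g)"
  proof -
    have "g = (g \<cdot> f) \<cdot> k" using k h(1) assms(2) assoc[of k f g] by simp
    also have "\<dots> = zero_arr C (Dom C g) (Cod C g)" using h k assms(2) by simp
    finally show ?thesis .
  qed
qed

lemma zero_object_isomorphic:
  assumes "isomorphic C a b" "zero_object C a"
  shows "zero_object C b"
proof -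
  obtain f where f: "iso_arrow C f" "Dom C f = a" "Cod C f = b" using assms(1) by (rule isomorphicE)
  obtain g where g: "f \<in> Arr C" "g \<in> Arr C" "Dom C g = Cod C f" "Cod C g = Dom C f"
    "f \<cdot> g = \<ii> (Cod C f)" using f(1) by (rule iso_arrowE)
  have ob: "a \<in> Obj C" "b \<in> Obj C" using isomorphic_obj[OF assms(1)] by auto
  have "\<ii> b = f \<cdot> \<ii> a \<cdot> g" using f g by simp
  also have "\<dots> = zero_arr C b b" using assms(2) f g ob by (simp add: zero_object_iff)
  finally show ?thesis using f g by (auto simp: zero_object_iff)
qed

lemma simple_object_isomorphic:
  assumes "isomorphic C s t" "simple_object C s"
  shows "simple_object C t"
proof -
  obtain f where f: "iso_arrow C f" "Dom C f = s" "Cod C f = t" using assms(1) by (rule isomorphicE)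
  obtain g where g: "f \<in> Arr C" "g \<in> Arr C" "Dom C g = Cod C f" "Cod C g = Dom C f"
    "g \<cdot> f = \<ii> (Dom C f)" "f \<cdot> g = \<ii> (Cod C f)" using f(1) by (rule iso_arrowE)
  have "zero_object C (Dom C i) \<or> iso_arrow C i" if i: "mono_arrow C i" "Cod C i = t" for i
  proof -
    have iA: "i \<in> Arr C" using i by (simp add: mono_arrow_def)
    have fgi: "f \<cdot> (g \<cdot> i) = i" using assoc[of i g f] iA i f g by simp
    have "mono_arrow C (g \<cdot> i)"
      unfolding mono_arrow_def
    proof (intro conjI ballI impI)
      show "g \<cdot> i \<in> Arr C" using iA i f g by simp
      fix a u v
      assume a: "a \<in> Obj C" and uv: "u \<in> Hom C a (Dom C (g \<cdot> i))" "v \<in> Hom C a (Dom C (g \<cdot> i))"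
        and eq: "g \<cdot> i \<cdot> u = g \<cdot> i \<cdot> v"
      have "f \<cdot> (g \<cdot> i \<cdot> u) = f \<cdot> (g \<cdot> i \<cdot> v)" using eq by simp
      moreover have "f \<cdot> (g \<cdot> i \<cdot> w) = i \<cdot> w" if "w \<in> Hom C a (Dom C (g \<cdot> i))" for w
        using that fgi assoc[of w "g \<cdot> i" f] iA i f g by (simp add: Hom_iff)
      ultimately have "i \<cdot> u = i \<cdot> v" using uv by simp
      moreover have "u \<in> Hom C a (Dom C i)" "v \<in> Hom C a (Dom C i)"
        using uv iA i f g by simp_all
      ultimately show "u = v" using i(1) a unfolding mono_arrow_def by blast
    qed
    moreover have "Cod C (g \<cdot> i) = s" using i f g iA by simp
    ultimately have "zero_object C (Dom C (g \<cdot> i)) \<or> iso_arrow C (g \<cdot> i)"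
      using assms(2) unfolding simple_object_def by blast
    then show ?thesis
    proof
      assume "iso_arrow C (g \<cdot> i)"
      from iso_arrow_comp[OF this f(1)] show ?thesis using fgi i f g iA by simp
    qed (use i f g iA in simp)
  qed
  moreover have "\<not> zero_object C t"
    using zero_object_isomorphic[OF isomorphic_sym[OF assms(1)]] assms(2)
    by (auto simp: simple_object_def)
  ultimately show ?thesis using f g by (auto simp: simple_object_def)
qed

lemma hom_sum_comp:
  assumes "finite I" "a \<in> Obj C" "b \<in> Obj C"
    and F: "\<And>i. i \<in> I \<Longrightarrow> F i \<in> Hom C a b"
    and f: "f \<in> Hom C a' a" and g: "g \<in> Hom C b b'"
  shows "g \<cdot> finsum (hom_space C a b) F I \<cdot> f = finsum (hom_space C a' b') (\<lambda>i. g \<cdot> F i \<cdot> f) I"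
proof -
  have ob: "a' \<in> Obj C" "b' \<in> Obj C" using f g by (auto simp: Hom_iff)
  interpret M: Module.module "ring_of_type_algebra :: complex ring" "hom_space C a b"
    using assms by (intro hom_vector_space)
  interpret N: Module.module "ring_of_type_algebra :: complex ring" "hom_space C a' b'"
    using ob by (intro hom_vector_space)
  show ?thesis using assms(1) F
  proof (induction I)
    case empty
    then show ?case using f g assms ob by (simp add: Hom_iff)
  next
    case (insert i I)
    have 1: "finsum (hom_space C a b) F I \<in> Hom C a b"
      using M.finsum_closed[of F I] insert by auto
    have 2: "g \<cdot> F j \<cdot> f \<in> Hom C a' b'" if "j \<in> insert i I" for j
      using insert.prems[OF that] f g by (auto simp: Hom_iff)
    have "finsum (hom_space C a b) F (insert i I) = F i \<^bold>+ finsum (hom_space C a b) F I"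
      using M.finsum_insert[of I i F] insert by (auto simp: Pi_iff)
    moreover have "finsum (hom_space C a' b') (\<lambda>i. g \<cdot> F i \<cdot> f) (insert i I) =
        g \<cdot> F i \<cdot> f \<^bold>+ finsum (hom_space C a' b') (\<lambda>i. g \<cdot> F i \<cdot> f) I"
      using N.finsum_insert[of I i "\<lambda>i. g \<cdot> F i \<cdot> f"] insert 2 by (auto simp: Pi_iff)
    ultimately show ?case
      using insert.IH insert.prems insert.prems[of i] 1 f g by (simp add: Hom_iff comp_add_distrib)
  qed
qed

lemma hom_sum_cong:
  assumes "a \<in> Obj C" "b \<in> Obj C" "\<And>i. i \<in> I \<Longrightarrow> F i \<in> Hom C a b" "\<And>i. i \<in> I \<Longrightarrow> G i = F i"
  shows "finsum (hom_space C a b) G I = finsum (hom_space C a b) F I"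
proof -
  interpret M: Module.module "ring_of_type_algebra :: complex ring" "hom_space C a b"
    using assms by (intro hom_vector_space)
  show ?thesis by (rule M.finsum_cong') (use assms in auto)
qed

lemma hom_sum_scale:
  assumes "finite I" "f \<in> Hom C a b"
  shows "finsum (hom_space C a b) (\<lambda>i. c i \<^bold>* f) I = (\<Sum>i\<in>I. c i) \<^bold>* f"
proof -
  have ob: "a \<in> Obj C" "b \<in> Obj C" using assms by (auto simp: Hom_iff)
  interpret M: Module.module "ring_of_type_algebra :: complex ring" "hom_space C a b"
    using ob by (intro hom_vector_space)
  show ?thesis using assms
  proof (induction I)
    case empty then show ?case by (simp add: Hom_iff)
  next
    case (insert i I)
    then show ?case using M.finsum_insert[of I i "\<lambda>i. c i \<^bold>* f"] by (simp add: Hom_iff scale_add_left)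
  qed
qed

end

section \<open>Biproduct decompositions\<close>

context linear_category
begin

text \<open>
  The resolution of the identity of a biproduct is used by inserting it in the middle of a composite.
\<close>

lemma direct_sumE:
  assumes "direct_sum C x as"
  obtains \<iota> \<pi> where
    "\<And>i. i < length as \<Longrightarrow> \<iota> i \<in> Arr C \<and> Dom C (\<iota> i) = as ! i \<and> Cod C (\<iota> i) = x"
    "\<And>i. i < length as \<Longrightarrow> \<pi> i \<in> Arr C \<and> Dom C (\<pi> i) = x \<and> Cod C (\<pi> i) = as ! i"
    "\<And>i. i < length as \<Longrightarrow> \<pi> i \<cdot> \<iota> i = \<ii> (as ! i)"
    "\<And>f g. f \<in> Arr C \<Longrightarrow> g \<in> Arr C \<Longrightarrow> Cod C f = x \<Longrightarrow> Dom C g = x \<Longrightarrow>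
      g \<cdot> f = finsum (hom_space C (Dom C f) (Cod C g)) (\<lambda>i. g \<cdot> (\<iota> i \<cdot> \<pi> i) \<cdot> f) {..<length as}"
proof -
  from assms obtain \<iota> \<pi> where x: "x \<in> Obj C"
    and i: "\<And>i. i < length as \<Longrightarrow> \<iota> i \<in> Hom C (as ! i) x \<and> \<pi> i \<in> Hom C x (as ! i)"
    and d: "\<And>i j. i < length as \<Longrightarrow> j < length as \<Longrightarrow>
        \<pi> j \<cdot> \<iota> i = (if i = j then \<ii> (as ! i) else zero_arr C (as ! i) (as ! j))"
    and s: "finsum (hom_space C x x) (\<lambda>i. \<iota> i \<cdot> \<pi> i) {..<length as} = \<ii> x"
    unfolding direct_sum_def by blast
  have "g \<cdot> f = finsum (hom_space C (Dom C f) (Cod C g)) (\<lambda>i. g \<cdot> (\<iota> i \<cdot> \<pi> i) \<cdot> f) {..<length as}"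
    if h: "f \<in> Arr C" "g \<in> Arr C" "Cod C f = x" "Dom C g = x" for f g
  proof -
    have "g \<cdot> f = g \<cdot> finsum (hom_space C x x) (\<lambda>i. \<iota> i \<cdot> \<pi> i) {..<length as} \<cdot> f"
      unfolding s using h by simp
    also have "\<dots> = finsum (hom_space C (Dom C f) (Cod C g)) (\<lambda>i. g \<cdot> (\<iota> i \<cdot> \<pi> i) \<cdot> f) {..<length as}"
      using x h i by (intro hom_sum_comp) (auto simp: Hom_iff)
    finally show ?thesis .
  qed
  with i d show ?thesis by (intro that[of \<iota> \<pi>]) (auto simp: Hom_iff)
qed

lemma direct_sum_single_component:
  assumes "direct_sum C x as"
    and d: "\<And>i. i < length as \<Longrightarrow> \<iota> i \<in> Arr C \<and> Dom C (\<iota> i) = as ! i \<and> Cod C (\<iota> i) = x"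
      "\<And>i. i < length as \<Longrightarrow> \<pi> i \<in> Arr C \<and> Dom C (\<pi> i) = x \<and> Cod C (\<pi> i) = as ! i"
      "\<And>f g. f \<in> Arr C \<Longrightarrow> g \<in> Arr C \<Longrightarrow> Cod C f = x \<Longrightarrow> Dom C g = x \<Longrightarrow>
      g \<cdot> f = finsum (hom_space C (Dom C f) (Cod C g)) (\<lambda>i. g \<cdot> (\<iota> i \<cdot> \<pi> i) \<cdot> f) {..<length as}"
    and v: "v \<in> Arr C" "Cod C v = x" and k: "k < length as"
    and z: "\<And>i. i < length as \<Longrightarrow> i \<noteq> k \<Longrightarrow> \<pi> i \<cdot> v = zero_arr C (Dom C v) (as ! i)"
  shows "\<iota> k \<cdot> (\<pi> k \<cdot> v) = v"
proof -
  have ob: "x \<in> Obj C" "Dom C v \<in> Obj C" using v by auto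
  have "v = finsum (hom_space C (Dom C v) x) (\<lambda>i. \<ii> x \<cdot> (\<iota> i \<cdot> \<pi> i) \<cdot> v) {..<length as}"
    using d(3)[of v "\<ii> x"] v ob by simp
  also have "\<dots> = finsum (hom_space C (Dom C v) x)
      (\<lambda>i. (if i = k then 1 else 0) \<^bold>* (\<iota> k \<cdot> (\<pi> k \<cdot> v))) {..<length as}"
  proof (rule hom_sum_cong)
    fix i assume "i \<in> {..<length as}"
    then have i: "i < length as" by simp
    show "\<ii> x \<cdot> (\<iota> i \<cdot> \<pi> i) \<cdot> v = (if i = k then 1 else 0) \<^bold>* (\<iota> k \<cdot> (\<pi> k \<cdot> v))"
      using d(1,2)[OF i] d(1,2)[OF k] z[OF i] v ob by (auto simp: assoc)
  qed (use d(1,2)[OF k] v ob in \<open>auto simp: Hom_iff\<close>)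
  also have "\<dots> = (\<Sum>i<length as. if i = k then 1 else 0) \<^bold>* (\<iota> k \<cdot> (\<pi> k \<cdot> v))"
    using d(1,2)[OF k] v by (intro hom_sum_scale) (auto simp: Hom_iff)
  also have "\<dots> = \<iota> k \<cdot> (\<pi> k \<cdot> v)" using k d(1,2)[OF k] v by (simp add: sum.delta)
  finally show ?thesis by simp
qed

lemma eq_on_summands:
  assumes dS: "direct_sum C w ss"
    and U: "U \<in> Arr C" "Dom C U = w" and V: "V \<in> Arr C" "Dom C V = w" "Cod C V = Cod C U"
    and eq: "\<And>v. v \<in> Arr C \<Longrightarrow> Dom C v \<in> set ss \<Longrightarrow> Cod C v = w \<Longrightarrow> U \<cdot> v = V \<cdot> v"
  shows "U = V"
proof -
  have w: "w \<in> Obj C" using U by auto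
  obtain \<iota> \<pi> where
    d: "\<And>i. i < length ss \<Longrightarrow> \<iota> i \<in> Arr C \<and> Dom C (\<iota> i) = ss ! i \<and> Cod C (\<iota> i) = w"
      "\<And>i. i < length ss \<Longrightarrow> \<pi> i \<in> Arr C \<and> Dom C (\<pi> i) = w \<and> Cod C (\<pi> i) = ss ! i"
      "\<And>f g. f \<in> Arr C \<Longrightarrow> g \<in> Arr C \<Longrightarrow> Cod C f = w \<Longrightarrow> Dom C g = w \<Longrightarrow>
        g \<cdot> f = finsum (hom_space C (Dom C f) (Cod C g)) (\<lambda>i. g \<cdot> (\<iota> i \<cdot> \<pi> i) \<cdot> f) {..<length ss}"
    using dS by (rule direct_sumE) blast
  have "U = finsum (hom_space C w (Cod C U)) (\<lambda>i. U \<cdot> (\<iota> i \<cdot> \<pi> i) \<cdot> \<ii> w) {..<length ss}"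
    using d(3)[of "\<ii> w" U] U w by simp
  also have "\<dots> = finsum (hom_space C w (Cod C U)) (\<lambda>i. V \<cdot> (\<iota> i \<cdot> \<pi> i) \<cdot> \<ii> w) {..<length ss}"
  proof (rule hom_sum_cong)
    fix i assume "i \<in> {..<length ss}"
    then have i: "i < length ss" by simp
    then have "U \<cdot> \<iota> i \<cdot> \<pi> i = V \<cdot> \<iota> i \<cdot> \<pi> i" using eq[of "\<iota> i"] d(1)[OF i] by simp
    then show "U \<cdot> (\<iota> i \<cdot> \<pi> i) \<cdot> \<ii> w = V \<cdot> (\<iota> i \<cdot> \<pi> i) \<cdot> \<ii> w"
      using d(1,2)[OF i] U V w by (simp add: assoc)
  next
    fix i assume "i \<in> {..<length ss}"
    then have i: "i < length ss" by simp
    show "V \<cdot> (\<iota> i \<cdot> \<pi> i) \<cdot> \<ii> w \<in> Hom C w (Cod C U)"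
      using d(1,2)[OF i] V w by (simp add: Hom_iff)
  qed (use U w in auto)
  also have "\<dots> = V" using d(3)[of "\<ii> w" V] V w by simp
  finally show ?thesis .
qed

lemma direct_sum_singleton:
  assumes "direct_sum C x [s]"
  shows "isomorphic C x s"
proof -
  obtain \<iota> \<pi> where
    d: "\<And>i. i < length [s] \<Longrightarrow> \<iota> i \<in> Arr C \<and> Dom C (\<iota> i) = [s] ! i \<and> Cod C (\<iota> i) = x"
      "\<And>i. i < length [s] \<Longrightarrow> \<pi> i \<in> Arr C \<and> Dom C (\<pi> i) = x \<and> Cod C (\<pi> i) = [s] ! i"
      "\<And>i. i < length [s] \<Longrightarrow> \<pi> i \<cdot> \<iota> i = \<ii> ([s] ! i)"
      "\<And>f g. f \<in> Arr C \<Longrightarrow> g \<in> Arr C \<Longrightarrow> Cod C f = x \<Longrightarrow> Dom C g = x \<Longrightarrow>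
        g \<cdot> f = finsum (hom_space C (Dom C f) (Cod C g)) (\<lambda>i. g \<cdot> (\<iota> i \<cdot> \<pi> i) \<cdot> f) {..<length [s]}"
    using assms by (rule direct_sumE) blast
  have x: "x \<in> Obj C" using assms by (simp add: direct_sum_def)
  have "\<iota> 0 \<cdot> (\<pi> 0 \<cdot> \<ii> x) = \<ii> x"
    by (rule direct_sum_single_component[OF assms d(1,2,4)]) (use x in auto)
  then have "iso_arrow C (\<pi> 0)"
    using d(1,2,3)[of 0] x by (intro iso_arrowI[where g = "\<iota> 0"]) auto
  then show ?thesis using d(2)[of 0] by (auto intro: isomorphicI)
qed

lemma nonzero_arr_from_simple_summand:
  assumes dec: "simple_decomposition C w ss" and t: "t \<in> set ss" "isomorphic C s t"
  shows "\<exists>v. v \<in> Arr C \<and> Dom C v = s \<and> Cod C v = w \<and> v \<noteq> zero_arr C s w"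
proof -
  have dS: "direct_sum C w ss" and sS: "\<And>s. s \<in> set ss \<Longrightarrow> simple_object C s"
    using dec by (auto simp: simple_decomposition_def)
  obtain i where i: "i < length ss" "t = ss ! i" using t by (auto simp: in_set_conv_nth)
  obtain \<iota> \<pi> where d: "\<iota> i \<in> Arr C \<and> Dom C (\<iota> i) = ss ! i \<and> Cod C (\<iota> i) = w"
      "\<pi> i \<in> Arr C \<and> Dom C (\<pi> i) = w \<and> Cod C (\<pi> i) = ss ! i" "\<pi> i \<cdot> \<iota> i = \<ii> (ss ! i)"
    using dS by (rule direct_sumE) (use i in blast)
  obtain f where f: "iso_arrow C f" "f \<in> Arr C" "Dom C f = s" "Cod C f = t"
    using t(2) by (rule isomorphicE)
  have "\<iota> i \<cdot> f \<noteq> zero_arr C s w"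
  proof
    assume "\<iota> i \<cdot> f = zero_arr C s w"
    then have "\<pi> i \<cdot> (\<iota> i \<cdot> f) = zero_arr C s t" using d i f by auto
    moreover have "\<pi> i \<cdot> (\<iota> i \<cdot> f) = f" using d i f assoc[of f "\<iota> i" "\<pi> i"] by simp
    moreover have "\<not> zero_object C s"
      using t sS zero_object_isomorphic[OF t(2)] by (auto simp: simple_object_def)
    ultimately show False using iso_arrow_nonzero[OF f(1)] f by simp
  qed
  then show ?thesis using d f i by (intro exI[of _ "\<iota> i \<cdot> f"]) auto
qed

end

section \<open>Schur's lemma\<close>

context abelian_category
begin

text \<open>
  The kernel of a nonzero \<open>f\<close> is a proper subobject of a simple object, hence zero, so \<open>f\<close> is mono; being
  a nonzero subobject of a simple object, it is an isomorphism.
\<close>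

lemma simple_nonzero_iso:
  assumes s: "simple_object C s" and t: "simple_object C t"
    and f: "f \<in> Arr C" "Dom C f = s" "Cod C f = t" "f \<noteq> zero_arr C s t"
  shows "iso_arrow C f"
proof -
  obtain k where "is_kernel C k f" using has_kernels f by blast
  then have k: "k \<in> Arr C" "Cod C k = s" "f \<cdot> k = zero_arr C (Dom C k) t"
    and u: "\<And>a g. a \<in> Obj C \<Longrightarrow> g \<in> Hom C a s \<Longrightarrow> f \<cdot> g = zero_arr C a t \<Longrightarrow>
      \<exists>!u. u \<in> Hom C a (Dom C k) \<and> k \<cdot> u = g"
    using f by (auto simp: is_kernel_def)
  have sO: "s \<in> Obj C" using s by (simp add: simple_object_def)
  have "mono_arrow C k"
    unfolding mono_arrow_def
  proof (intro conjI ballI impI)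
    fix a g h assume a: "a \<in> Obj C" "g \<in> Hom C a (Dom C k)" "h \<in> Hom C a (Dom C k)" "k \<cdot> g = k \<cdot> h"
    have "f \<cdot> (k \<cdot> g) = zero_arr C a t"
      using a k f assoc[of g k f] by (auto simp: Hom_iff)
    then show "g = h" using u[of a "k \<cdot> g"] a k by (auto simp: Hom_iff)
  qed fact
  then have "zero_object C (Dom C k) \<or> iso_arrow C k"
    using s k(2) unfolding simple_object_def by blast
  moreover have "\<not> iso_arrow C k"
    using iso_comp_zero_cancel(2)[of k f] k f by auto
  ultimately have z: "zero_object C (Dom C k)" by blast
  have "mono_arrow C f"
    unfolding mono_arrow_def
  proof (intro conjI ballI impI)
    fix a g h assume a: "a \<in> Obj C" "g \<in> Hom C a (Dom C f)" "h \<in> Hom C a (Dom C f)" "f \<cdot> g = f \<cdot> h"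
    have "f \<cdot> (g \<^bold>+ (-1) \<^bold>* h) = f \<cdot> h \<^bold>+ (-1) \<^bold>* (f \<cdot> h)"
      using a f by (simp add: Hom_iff comp_add_distrib)
    also have "\<dots> = (1 + (-1)) \<^bold>* (f \<cdot> h)"
      using a f by (subst scale_add_left) (simp_all add: Hom_iff)
    also have "\<dots> = zero_arr C a t" using a f by (simp add: Hom_iff)
    finally obtain w where w: "w \<in> Hom C a (Dom C k)" "k \<cdot> w = g \<^bold>+ (-1) \<^bold>* h"
      using u[of a "g \<^bold>+ (-1) \<^bold>* h"] a f by (auto simp: Hom_iff)
    have "w = zero_arr C a (Dom C k)"
    proof -
      have "w = \<ii> (Dom C k) \<cdot> w" using w(1) by (simp add: Hom_iff)
      also have "\<dots> = zero_arr C a (Dom C k)" using w(1) z k a by (simp add: zero_object_iff Hom_iff)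
      finally show ?thesis .
    qed
    then have "g \<^bold>+ (-1) \<^bold>* h = zero_arr C a s" using w a k by simp
    then show "g = h" by - (rule eq_if_diff_zero, use a f in \<open>simp_all add: Hom_iff\<close>)
  qed (rule f)
  then have "zero_object C (Dom C f) \<or> iso_arrow C f"
    using t f(3) unfolding simple_object_def by blast
  then show ?thesis using f(2) s by (simp add: simple_object_def)
qed

end

text \<open>
  More vectors than coordinates are dependent, by Gaussian elimination.  The vectors are an indexed family
  rather than a set, so that repetitions among the powers of an endomorphism need no separate case.
\<close>

lemma exists_linear_dependence:
  fixes c :: "'k \<Rightarrow> 'b \<Rightarrow> complex"
  assumes "finite B" "finite K" "card B < card K"
  shows "\<exists>a. (\<exists>k\<in>K. a k \<noteq> 0) \<and> (\<forall>b\<in>B. (\<Sum>k\<in>K. a k * c k b) = 0)"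
  using assms
proof (induction B arbitrary: K c rule: finite_induct)
  case empty
  then show ?case by (intro exI[of _ "\<lambda>_. 1"]) (auto simp: card_gt_0_iff)
next
  case (insert b B)
  show ?case
  proof (cases "\<forall>k\<in>K. c k b = 0")
    case True
    have "card B < card K" using insert by simp
    from insert.IH[OF insert.prems(1) this, of c] show ?thesis using True by auto
  next
    case False
    then obtain k0 where k0: "k0 \<in> K" "c k0 b \<noteq> 0" by blast
    have "card B < card (K - {k0})" using insert k0 by simp
    from insert.IH[OF _ this, of "\<lambda>k b'. c k b' - c k b / c k0 b * c k0 b'"] insert.prems
    obtain a where a: "\<exists>k\<in>K - {k0}. a k \<noteq> 0"
      "\<And>b'. b' \<in> B \<Longrightarrow> (\<Sum>k\<in>K - {k0}. a k * (c k b' - c k b / c k0 b * c k0 b')) = 0" by auto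
    \<comment> \<open>the coefficient of the pivot row \<open>k0\<close> is chosen to make coordinate \<open>b\<close> vanish\<close>
    define a' where "a' = a(k0 := - (\<Sum>k\<in>K - {k0}. a k * c k b) / c k0 b)"
    have eq: "(\<Sum>k\<in>K. a' k * c k b') = (\<Sum>k\<in>K - {k0}. a k * (c k b' - c k b / c k0 b * c k0 b'))" for b'
    proof -
      have "(\<Sum>k\<in>K. a' k * c k b') = a' k0 * c k0 b' + (\<Sum>k\<in>K - {k0}. a' k * c k b')"
        using insert.prems k0 by (subst sum.remove[of K k0]) auto
      also have "(\<Sum>k\<in>K - {k0}. a' k * c k b') = (\<Sum>k\<in>K - {k0}. a k * c k b')"
        by (rule sum.cong) (auto simp: a'_def)
      also have "a' k0 * c k0 b' = - (\<Sum>k\<in>K - {k0}. a k * (c k b / c k0 b * c k0 b'))"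
        by (simp add: a'_def sum_distrib_left sum_divide_distrib mult_ac)
      finally show ?thesis by (simp add: algebra_simps sum_subtractf)
    qed
    have "\<exists>k\<in>K. a' k \<noteq> 0" using a(1) by (auto simp: a'_def)
    moreover have "(\<Sum>k\<in>K. a' k * c k b') = 0" if "b' \<in> insert b B" for b'
      using that a(2) k0 unfolding eq by auto
    ultimately show ?thesis by blast
  qed
qed

text \<open>
  Evaluation of a polynomial at an endomorphism, by Horner's scheme.
\<close>

definition (in linear_category) arr_poly :: "'m \<Rightarrow> complex poly \<Rightarrow> 'm" where
  "arr_poly f p = fold_coeffs (\<lambda>a r. a \<^bold>* \<ii> (Dom C f) \<^bold>+ f \<cdot> r) p (zero_arr C (Dom C f) (Dom C f))"

context linear_category
begin

context
  fixes s f assumes f: "f \<in> Arr C" "Dom C f = s" "Cod C f = s"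
begin

lemma endo_obj: "s \<in> Obj C" using f by auto

lemma arr_poly_0: "arr_poly f 0 = zero_arr C s s"
  by (simp add: arr_poly_def f)

lemma arr_poly_pCons: "arr_poly f (pCons a p) = a \<^bold>* \<ii> s \<^bold>+ f \<cdot> arr_poly f p"
proof (cases "a = 0 \<and> p = 0")
  case True
  then show ?thesis using f endo_obj add_zero[of "zero_arr C s s" "zero_arr C s s"] by (simp add: arr_poly_0)
next
  case False
  then have "fold_coeffs F (pCons a p) = F a \<circ> fold_coeffs F p" for F :: "complex \<Rightarrow> 'm \<Rightarrow> 'm"
    by auto
  then show ?thesis by (simp add: arr_poly_def f)
qed

lemma arr_arr_poly: "arr_poly f p \<in> Arr C \<and> Dom C (arr_poly f p) = s \<and> Cod C (arr_poly f p) = s"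
  by (induction p) (use f endo_obj in \<open>simp_all add: arr_poly_0 arr_poly_pCons\<close>)

lemma arr_poly_smult: "arr_poly f (smult a p) = a \<^bold>* arr_poly f p"
  by (induction p) (use f endo_obj arr_arr_poly in \<open>simp_all add: arr_poly_0 arr_poly_pCons scale_add_right\<close>)

lemma add_interchange:
  assumes "p \<in> Hom C s s" "q \<in> Hom C s s" "p' \<in> Hom C s s" "q' \<in> Hom C s s"
  shows "(p \<^bold>+ q) \<^bold>+ (p' \<^bold>+ q') = (p \<^bold>+ p') \<^bold>+ (q \<^bold>+ q')"
proof -
  have "(p \<^bold>+ q) \<^bold>+ (p' \<^bold>+ q') = p \<^bold>+ ((q \<^bold>+ p') \<^bold>+ q')"
    using assms by (simp add: Hom_iff add_assoc)
  also have "q \<^bold>+ p' = p' \<^bold>+ q" using assms by (intro add_commute) (simp_all add: Hom_iff)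
  finally show ?thesis using assms by (simp add: Hom_iff add_assoc)
qed

lemma arr_poly_add: "arr_poly f (p + q) = arr_poly f p \<^bold>+ arr_poly f q"
proof (induction p q rule: poly_induct2)
  case 0
  then show ?case using endo_obj add_zero[of "zero_arr C s s" "zero_arr C s s"] by (simp add: arr_poly_0)
next
  case (pCons a p b q)
  have "arr_poly f (pCons a p + pCons b q) =
      (a \<^bold>* \<ii> s \<^bold>+ b \<^bold>* \<ii> s) \<^bold>+ (f \<cdot> arr_poly f p \<^bold>+ f \<cdot> arr_poly f q)"
    using f endo_obj arr_arr_poly[of p] arr_arr_poly[of q] pCons
    by (simp add: arr_poly_pCons scale_add_left comp_add_distrib)
  also have "\<dots> = arr_poly f (pCons a p) \<^bold>+ arr_poly f (pCons b q)"
    using f endo_obj arr_arr_poly[of p] arr_arr_poly[of q] unfolding arr_poly_pCons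
    by (intro add_interchange) (simp_all add: Hom_iff)
  finally show ?case .
qed

lemma arr_poly_linear_factor:
  "arr_poly f ([:- z, 1:] * q) = (f \<^bold>+ (- z) \<^bold>* \<ii> s) \<cdot> arr_poly f q"
proof -
  have "[:- z, 1:] * q = pCons 0 q + smult (- z) q" by simp
  moreover have "arr_poly f (pCons 0 q) = f \<cdot> arr_poly f q"
    using f endo_obj arr_arr_poly[of q] add_zero(2)[of "f \<cdot> arr_poly f q" "f \<cdot> arr_poly f q"]
    by (simp add: arr_poly_pCons)
  ultimately have "arr_poly f ([:- z, 1:] * q) = f \<cdot> arr_poly f q \<^bold>+ (- z) \<^bold>* arr_poly f q"
    by (simp only: arr_poly_add arr_poly_smult)
  also have "\<dots> = (f \<^bold>+ (- z) \<^bold>* \<ii> s) \<cdot> arr_poly f q"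
    using f endo_obj arr_arr_poly[of q] by (simp add: comp_add_distrib)
  finally show ?thesis .
qed

text \<open>
  The powers of \<open>f\<close> up to the size of a finite spanning set are dependent: expressed through the spanning
  set, they are more coordinate vectors than there are coordinates.
\<close>

lemma exists_annihilating_poly:
  assumes "finite_dim_hom C s s"
  shows "\<exists>p. p \<noteq> 0 \<and> arr_poly f p = zero_arr C s s"
proof -
  obtain B where B: "finite B" "B \<subseteq> Hom C s s"
    "\<forall>g \<in> Hom C s s. \<exists>c. g = finsum (hom_space C s s) (\<lambda>e. c e \<^bold>* e) B"
    using assms unfolding finite_dim_hom_def by blast
  interpret M: Module.module "ring_of_type_algebra :: complex ring" "hom_space C s s"
    using endo_obj by (intro hom_vector_space)
  \<comment> \<open>\<open>L\<close> maps coordinates to arrows; it is linear and onto, and the spanning set may be dependent\<close>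
  define L where "L c = finsum (hom_space C s s) (\<lambda>e. c e \<^bold>* e) B" for c
  have L_Hom: "(\<lambda>e. c e \<^bold>* e) \<in> B \<rightarrow> carrier (hom_space C s s)" for c
    using B by (auto simp: Hom_iff)
  have L_add: "L (\<lambda>e. c e + d e) = L c \<^bold>+ L d" for c d
  proof -
    have "L (\<lambda>e. c e + d e) = finsum (hom_space C s s) (\<lambda>e. c e \<^bold>* e \<^bold>+ d e \<^bold>* e) B"
      unfolding L_def using B endo_obj
      by (intro hom_sum_cong) (auto simp: Hom_iff subset_iff scale_add_left)
    also have "\<dots> = L c \<^bold>+ L d"
      using M.finsum_addf[OF L_Hom L_Hom, of c d] by (simp add: L_def)
    finally show ?thesis .
  qed
  have L_scale: "L (\<lambda>e. t * c e) = t \<^bold>* L c" for t c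
  proof -
    have "t \<^bold>* L c = (t \<^bold>* \<ii> s) \<cdot> L c \<cdot> \<ii> s"
      using M.finsum_closed[OF L_Hom, of c] endo_obj by (simp add: Hom_iff L_def)
    also have "\<dots> = finsum (hom_space C s s) (\<lambda>e. (t \<^bold>* \<ii> s) \<cdot> (c e \<^bold>* e) \<cdot> \<ii> s) B"
      unfolding L_def using B endo_obj by (intro hom_sum_comp) (auto simp: Hom_iff)
    also have "\<dots> = L (\<lambda>e. t * c e)"
      unfolding L_def using B endo_obj
      by (intro hom_sum_cong) (auto simp: Hom_iff subset_iff mult.commute)
    finally show ?thesis by simp
  qed
  have L_0: "L (\<lambda>e. 0) = zero_arr C s s"
    using L_scale[of 0 "\<lambda>_. 0"] M.finsum_closed[OF L_Hom, of "\<lambda>_. 0"] endo_obj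
    by (simp add: Hom_iff L_def)
  have "\<exists>c. arr_poly f (monom 1 k) = L c" for k
    using B(3) arr_arr_poly[of "monom 1 k"] by (auto simp: L_def Hom_iff)
  then obtain c where c: "\<And>k. arr_poly f (monom 1 k) = L (c k)" by metis
  obtain a where a: "\<exists>k\<in>{..card B}. a k \<noteq> 0" "\<And>b. b \<in> B \<Longrightarrow> (\<Sum>k\<le>card B. a k * c k b) = 0"
    using exists_linear_dependence[of B "{..card B}" c] B(1) by auto
  have expand: "arr_poly f (\<Sum>k<n. monom (a k) k) = L (\<lambda>e. \<Sum>k<n. a k * c k e)" for n
  proof (induction n)
    case 0
    then show ?case by (simp add: L_0 arr_poly_0)
  next
    case (Suc n)
    have "arr_poly f (monom (a n) n) = L (\<lambda>e. a n * c n e)"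
      using arr_poly_smult[of "a n" "monom 1 n"] by (simp add: smult_monom L_scale c)
    with Suc show ?case by (simp add: arr_poly_add L_add)
  qed
  define p where "p = (\<Sum>k<Suc (card B). monom (a k) k)"
  have "arr_poly f p = L (\<lambda>e. \<Sum>k\<le>card B. a k * c k e)"
    unfolding p_def expand by (simp only: lessThan_Suc_atMost)
  also have "\<dots> = L (\<lambda>e. 0)"
    unfolding L_def using B endo_obj a(2) by (intro hom_sum_cong) (auto simp: Hom_iff)
  finally have "arr_poly f p = zero_arr C s s" using L_0 by simp
  moreover obtain k where k: "k \<le> card B" "a k \<noteq> 0" using a(1) by auto
  have "coeff p k = a k"
    using k(1) unfolding p_def coeff_sum
    by (subst sum.mono_neutral_right[of _ "{k}"]) auto
  then have "p \<noteq> 0" using k by auto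
  ultimately show ?thesis by blast
qed

end

end

context fusion_category
begin

text \<open>
  An annihilating polynomial of least degree splits off a linear factor \<open>f - z\<close>.  Its cofactor evaluates to
  a nonzero endomorphism of a simple object, hence to an isomorphism, and so \<open>f - z\<close> vanishes.
\<close>

lemma simple_endo_scalar:
  assumes s: "simple_object C s" and f: "f \<in> Arr C" "Dom C f = s" "Cod C f = s"
  shows "\<exists>z. f = z \<^bold>* \<ii> s"
proof -
  have sO: "s \<in> Obj C" using s by (simp add: simple_object_def)
  have nz: "\<ii> s \<noteq> zero_arr C s s" using s by (auto simp: simple_object_def zero_object_iff)
  have "\<exists>z. f = z \<^bold>* \<ii> s" if "p \<noteq> 0" "arr_poly f p = zero_arr C s s" for p
    using that
  proof (induction "degree p" arbitrary: p rule: less_induct)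
    case less
    show ?case
    proof (cases "degree p = 0")
      case True
      then obtain a where p: "p = [:a:]" using degree_eq_zeroE by blast
      then have "a \<^bold>* \<ii> s \<^bold>+ zero_arr C s s = zero_arr C s s"
        using less.prems f sO by (simp add: arr_poly_pCons[OF f] arr_poly_0[OF f])
      then have "a \<^bold>* \<ii> s = 0 \<^bold>* \<ii> s" using sO add_zero(1)[of "a \<^bold>* \<ii> s" "a \<^bold>* \<ii> s"] by simp
      then have "a = 0" using scale_cancel[of "\<ii> s" a 0] sO nz by simp
      then show ?thesis using p less.prems by simp
    next
      case False
      then obtain z where "poly p z = 0"
        using fundamental_theorem_of_algebra[of p] constant_degree[of p] by auto
      then obtain q where q: "p = [:- z, 1:] * q" by (auto simp: poly_eq_0_iff_dvd elim: dvdE)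
      then have q0: "q \<noteq> 0" using less.prems by auto
      have "degree p = Suc (degree q)" unfolding q using q0 by (subst degree_mult_eq) auto
      let ?h = "f \<^bold>+ (- z) \<^bold>* \<ii> s" and ?g = "arr_poly f q"
      have h: "?h \<in> Arr C" "Dom C ?h = s" "Cod C ?h = s" using f sO by simp_all
      have g: "?g \<in> Arr C" "Dom C ?g = s" "Cod C ?g = s" using arr_arr_poly[OF f, of q] by simp_all
      have hg: "?h \<cdot> ?g = zero_arr C s s"
        using less.prems(2) unfolding q arr_poly_linear_factor[OF f] .
      show ?thesis
      proof (cases "?g = zero_arr C s s")
        case True
        then show ?thesis using less.hyps[of q] q0 \<open>degree p = Suc (degree q)\<close> by simp
      next
        case False
        then have "iso_arrow C ?g" using simple_nonzero_iso[OF s s g] by blast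
        then have "?h = zero_arr C s s" using iso_comp_zero_cancel(2)[of ?g ?h] h g hg by simp
        then have "f \<^bold>+ (-1) \<^bold>* z \<^bold>* \<ii> s = zero_arr C s s" using sO by simp
        then have "f = z \<^bold>* \<ii> s" by - (rule eq_if_diff_zero, use f sO in simp_all)
        then show ?thesis by blast
      qed
    qed
  qed
  then show ?thesis
    using exists_annihilating_poly[OF f finite_dim_homs[OF sO sO]] by blast
qed

lemma simple_hom_proportional:
  assumes s: "simple_object C s" and t: "simple_object C t"
    and f: "f \<in> Arr C" "Dom C f = s" "Cod C f = t" "f \<noteq> zero_arr C s t"
    and g: "g \<in> Arr C" "Dom C g = s" "Cod C g = t"
  shows "\<exists>z. g = z \<^bold>* f"
proof -
  have "iso_arrow C f" by (rule simple_nonzero_iso[OF s t f])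
  then obtain k where k: "k \<in> Arr C" "Dom C k = t" "Cod C k = s" "f \<cdot> k = \<ii> t"
    using f by (auto elim: iso_arrowE)
  obtain z where z: "k \<cdot> g = z \<^bold>* \<ii> s"
    using simple_endo_scalar[OF s, of "k \<cdot> g"] k g by auto
  have "g = f \<cdot> (k \<cdot> g)" using assoc[of g k f] f g k by simp
  also have "\<dots> = z \<^bold>* f" unfolding z using f by (subst comp_scale) auto
  finally show ?thesis by blast
qed

lemma simple_hom_zero:
  assumes "simple_object C s" "simple_object C t" "\<not> isomorphic C s t"
    and "f \<in> Arr C" "Dom C f = s" "Cod C f = t"
  shows "f = zero_arr C s t"
  using simple_nonzero_iso[OF assms(1,2,4,5,6)] isomorphicI[of f s t] assms(3,5,6) by auto

section \<open>Multiplicities\<close>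

text \<open>
  Passing from summand \<open>i\<close> of one decomposition to summand \<open>j\<close> of the other and back is a scalar
  \<open>c i j\<close>, independent of the side on which one starts and zero unless the summands are isomorphic.  All
  row and column sums are \<open>1\<close>, so summing over the block of one isomorphism class counts its members in
  either decomposition.
\<close>

lemma decomposition_multiplicity_unique:
  assumes S: "simple_decomposition C x ss" and T: "simple_decomposition C x ts"
    and r: "simple_object C r"
  shows "length (filter (\<lambda>s. s \<in> iso_class C r) ss) = length (filter (\<lambda>s. s \<in> iso_class C r) ts)"
proof -
  have dS: "direct_sum C x ss" and dT: "direct_sum C x ts"
    and sS: "\<And>s. s \<in> set ss \<Longrightarrow> simple_object C s" and sT: "\<And>s. s \<in> set ts \<Longrightarrow> simple_object C s"
    using S T by (auto simp: simple_decomposition_def)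
  obtain \<iota> \<pi> where
    a: "\<And>i. i < length ss \<Longrightarrow> \<iota> i \<in> Arr C \<and> Dom C (\<iota> i) = ss ! i \<and> Cod C (\<iota> i) = x"
      "\<And>i. i < length ss \<Longrightarrow> \<pi> i \<in> Arr C \<and> Dom C (\<pi> i) = x \<and> Cod C (\<pi> i) = ss ! i"
      "\<And>i. i < length ss \<Longrightarrow> \<pi> i \<cdot> \<iota> i = \<ii> (ss ! i)"
      "\<And>f g. f \<in> Arr C \<Longrightarrow> g \<in> Arr C \<Longrightarrow> Cod C f = x \<Longrightarrow> Dom C g = x \<Longrightarrow>
        g \<cdot> f = finsum (hom_space C (Dom C f) (Cod C g)) (\<lambda>i. g \<cdot> (\<iota> i \<cdot> \<pi> i) \<cdot> f) {..<length ss}"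
    using dS by (rule direct_sumE) blast
  obtain \<iota>' \<pi>' where
    b: "\<And>i. i < length ts \<Longrightarrow> \<iota>' i \<in> Arr C \<and> Dom C (\<iota>' i) = ts ! i \<and> Cod C (\<iota>' i) = x"
      "\<And>i. i < length ts \<Longrightarrow> \<pi>' i \<in> Arr C \<and> Dom C (\<pi>' i) = x \<and> Cod C (\<pi>' i) = ts ! i"
      "\<And>i. i < length ts \<Longrightarrow> \<pi>' i \<cdot> \<iota>' i = \<ii> (ts ! i)"
      "\<And>f g. f \<in> Arr C \<Longrightarrow> g \<in> Arr C \<Longrightarrow> Cod C f = x \<Longrightarrow> Dom C g = x \<Longrightarrow>
        g \<cdot> f = finsum (hom_space C (Dom C f) (Cod C g)) (\<lambda>i. g \<cdot> (\<iota>' i \<cdot> \<pi>' i) \<cdot> f) {..<length ts}"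
    using dT by (rule direct_sumE) blast
  define u where "u i j = \<pi>' j \<cdot> \<iota> i" for i j
  define v where "v i j = \<pi> i \<cdot> \<iota>' j" for i j
  have u: "u i j \<in> Arr C \<and> Dom C (u i j) = ss ! i \<and> Cod C (u i j) = ts ! j"
    and v: "v i j \<in> Arr C \<and> Dom C (v i j) = ts ! j \<and> Cod C (v i j) = ss ! i"
    if "i < length ss" "j < length ts" for i j
    using a(1,2)[OF that(1)] b(1,2)[OF that(2)] by (simp_all add: u_def v_def)
  \<comment> \<open>evaluating \<open>u i j \<cdot> v i j \<cdot> u i j\<close> from either end identifies the two scalars unless \<open>u i j = 0\<close>\<close>
  have "\<exists>c. v i j \<cdot> u i j = c \<^bold>* \<ii> (ss ! i) \<and> u i j \<cdot> v i j = c \<^bold>* \<ii> (ts ! j) \<and>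
      (\<not> isomorphic C (ss ! i) (ts ! j) \<longrightarrow> c = 0)"
    if ij: "i < length ss" "j < length ts" for i j
  proof -
    let ?s = "ss ! i" and ?t = "ts ! j"
    have s: "simple_object C ?s" and t: "simple_object C ?t" using sS sT ij by auto
    have st: "?s \<in> Obj C" "?t \<in> Obj C" using s t by (auto simp: simple_object_def)
    note uv = u[OF ij] v[OF ij]
    show ?thesis
    proof (cases "u i j = zero_arr C ?s ?t")
      case True
      then show ?thesis using uv st by (intro exI[of _ 0]) simp
    next
      case False
      obtain c where c: "v i j \<cdot> u i j = c \<^bold>* \<ii> ?s"
        using simple_endo_scalar[OF s, of "v i j \<cdot> u i j"] uv by auto
      obtain d where d: "u i j \<cdot> v i j = d \<^bold>* \<ii> ?t"
        using simple_endo_scalar[OF t, of "u i j \<cdot> v i j"] uv by auto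
      have "c \<^bold>* u i j = u i j \<cdot> (v i j \<cdot> u i j)" unfolding c using uv st by simp
      also have "\<dots> = u i j \<cdot> v i j \<cdot> u i j" using uv by (simp add: assoc)
      also have "\<dots> = d \<^bold>* u i j" unfolding d using uv st by simp
      finally have "c = d" using scale_cancel[of "u i j" c d] False uv by simp
      moreover have "isomorphic C ?s ?t"
        using simple_nonzero_iso[OF s t _ _ _ False] uv by (auto intro: isomorphicI)
      ultimately show ?thesis using c d by blast
    qed
  qed
  then obtain c where c: "\<And>i j. i < length ss \<Longrightarrow> j < length ts \<Longrightarrow> v i j \<cdot> u i j = c i j \<^bold>* \<ii> (ss ! i)"
    "\<And>i j. i < length ss \<Longrightarrow> j < length ts \<Longrightarrow> u i j \<cdot> v i j = c i j \<^bold>* \<ii> (ts ! j)"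
    "\<And>i j. i < length ss \<Longrightarrow> j < length ts \<Longrightarrow> \<not> isomorphic C (ss ! i) (ts ! j) \<Longrightarrow> c i j = 0"
    by metis
  have row: "(\<Sum>j<length ts. c i j) = 1" if i: "i < length ss" for i
  proof -
    have s: "simple_object C (ss ! i)" using sS i by auto
    then have sO: "ss ! i \<in> Obj C" by (simp add: simple_object_def)
    have "\<ii> (ss ! i) = finsum (hom_space C (ss ! i) (ss ! i)) (\<lambda>j. \<pi> i \<cdot> (\<iota>' j \<cdot> \<pi>' j) \<cdot> \<iota> i) {..<length ts}"
      using b(4)[of "\<iota> i" "\<pi> i"] a(1-3)[OF i] by simp
    also have "\<dots> = finsum (hom_space C (ss ! i) (ss ! i)) (\<lambda>j. c i j \<^bold>* \<ii> (ss ! i)) {..<length ts}"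
    proof (rule hom_sum_cong)
      fix j assume "j \<in> {..<length ts}"
      then have j: "j < length ts" by simp
      have "\<pi> i \<cdot> (\<iota>' j \<cdot> \<pi>' j) \<cdot> \<iota> i = v i j \<cdot> u i j"
        unfolding u_def v_def using a(1,2)[OF i] b(1,2)[OF j] by (simp add: assoc)
      then show "\<pi> i \<cdot> (\<iota>' j \<cdot> \<pi>' j) \<cdot> \<iota> i = c i j \<^bold>* \<ii> (ss ! i)" using c(1)[OF i j] by simp
    qed (use sO in \<open>auto simp: Hom_iff\<close>)
    also have "\<dots> = (\<Sum>j<length ts. c i j) \<^bold>* \<ii> (ss ! i)"
      using sO by (intro hom_sum_scale) (auto simp: Hom_iff)
    finally show ?thesis
      using scale_cancel[of "\<ii> (ss ! i)" "\<Sum>j<length ts. c i j" 1] s sO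
      by (auto simp: simple_object_def zero_object_iff)
  qed
  have col: "(\<Sum>i<length ss. c i j) = 1" if j: "j < length ts" for j
  proof -
    have s: "simple_object C (ts ! j)" using sT j by auto
    then have sO: "ts ! j \<in> Obj C" by (simp add: simple_object_def)
    have "\<ii> (ts ! j) = finsum (hom_space C (ts ! j) (ts ! j)) (\<lambda>i. \<pi>' j \<cdot> (\<iota> i \<cdot> \<pi> i) \<cdot> \<iota>' j) {..<length ss}"
      using a(4)[of "\<iota>' j" "\<pi>' j"] b(1-3)[OF j] by simp
    also have "\<dots> = finsum (hom_space C (ts ! j) (ts ! j)) (\<lambda>i. c i j \<^bold>* \<ii> (ts ! j)) {..<length ss}"
    proof (rule hom_sum_cong)
      fix i assume "i \<in> {..<length ss}"
      then have i: "i < length ss" by simp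
      have "\<pi>' j \<cdot> (\<iota> i \<cdot> \<pi> i) \<cdot> \<iota>' j = u i j \<cdot> v i j"
        unfolding u_def v_def using a(1,2)[OF i] b(1,2)[OF j] by (simp add: assoc)
      then show "\<pi>' j \<cdot> (\<iota> i \<cdot> \<pi> i) \<cdot> \<iota>' j = c i j \<^bold>* \<ii> (ts ! j)" using c(2)[OF i j] by simp
    qed (use sO in \<open>auto simp: Hom_iff\<close>)
    also have "\<dots> = (\<Sum>i<length ss. c i j) \<^bold>* \<ii> (ts ! j)"
      using sO by (intro hom_sum_scale) (auto simp: Hom_iff)
    finally show ?thesis
      using scale_cancel[of "\<ii> (ts ! j)" "\<Sum>i<length ss. c i j" 1] s sO
      by (auto simp: simple_object_def zero_object_iff)
  qed
  define I where "I = {i. i < length ss \<and> ss ! i \<in> iso_class C r}"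
  define J where "J = {j. j < length ts \<and> ts ! j \<in> iso_class C r}"
  have c0: "c i j = 0" if "i < length ss" "j < length ts" "(i \<in> I) \<noteq> (j \<in> J)" for i j
  proof -
    have "\<not> isomorphic C (ss ! i) (ts ! j)"
      using that isomorphic_trans isomorphic_sym isomorphic_obj
      unfolding I_def J_def iso_class_def by blast
    then show ?thesis using c(3) that by blast
  qed
  have "of_nat (card I) = (\<Sum>i\<in>I. \<Sum>j<length ts. c i j)"
    using row by (simp add: I_def)
  also have "\<dots> = (\<Sum>i\<in>I. \<Sum>j\<in>J. c i j)"
    by (intro sum.cong refl sum.mono_neutral_right) (auto simp: c0 J_def I_def)
  also have "\<dots> = (\<Sum>j\<in>J. \<Sum>i\<in>I. c i j)" by (rule sum.swap)
  also have "\<dots> = (\<Sum>j\<in>J. \<Sum>i<length ss. c i j)"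
    by (intro sum.cong refl sum.mono_neutral_left) (auto simp: c0 J_def I_def)
  also have "\<dots> = of_nat (card J)" using col by (simp add: J_def)
  finally have "card I = card J" by (simp only: of_nat_eq_iff)
  then show ?thesis by (simp add: length_filter_conv_card I_def J_def)
qed

lemma multiplicity_in_eq:
  assumes "simple_decomposition C x ss" "simple_object C r"
  shows "multiplicity_in C x (iso_class C r) = length (filter (\<lambda>s. s \<in> iso_class C r) ss)"
  unfolding multiplicity_in_def
  by (rule the_equality) (use assms decomposition_multiplicity_unique in blast)+

text \<open>
  Every arrow from an object isomorphic to \<open>r\<close> into \<open>w\<close> factors through the only summand of that class, on
  which \<open>T\<close> acts by a scalar.  Ranging over all such arrows makes the eigenvalue depend on the class only.
\<close>

lemma isotypic_eigenvalue:
  assumes dec: "simple_decomposition C w ss" and r: "simple_object C r"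
    and one: "length (filter (\<lambda>s. s \<in> iso_class C r) ss) = 1"
    and T: "T \<in> Arr C" "Dom C T = w" "Cod C T = w"
  shows "\<exists>t. \<forall>v \<in> Arr C. isomorphic C r (Dom C v) \<longrightarrow> Cod C v = w \<longrightarrow> T \<cdot> v = t \<^bold>* v"
proof -
  have dS: "direct_sum C w ss" and sS: "\<And>s. s \<in> set ss \<Longrightarrow> simple_object C s"
    using dec by (auto simp: simple_decomposition_def)
  obtain \<iota> \<pi> where
    d: "\<And>i. i < length ss \<Longrightarrow> \<iota> i \<in> Arr C \<and> Dom C (\<iota> i) = ss ! i \<and> Cod C (\<iota> i) = w"
      "\<And>i. i < length ss \<Longrightarrow> \<pi> i \<in> Arr C \<and> Dom C (\<pi> i) = w \<and> Cod C (\<pi> i) = ss ! i"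
      "\<And>f g. f \<in> Arr C \<Longrightarrow> g \<in> Arr C \<Longrightarrow> Cod C f = w \<Longrightarrow> Dom C g = w \<Longrightarrow>
        g \<cdot> f = finsum (hom_space C (Dom C f) (Cod C g)) (\<lambda>i. g \<cdot> (\<iota> i \<cdot> \<pi> i) \<cdot> f) {..<length ss}"
    using dS by (rule direct_sumE) blast
  have "card {i. i < length ss \<and> ss ! i \<in> iso_class C r} = 1"
    using one by (simp add: length_filter_conv_card)
  then obtain k where "{i. i < length ss \<and> ss ! i \<in> iso_class C r} = {k}"
    by (auto simp: card_1_singleton_iff)
  then have k: "k < length ss" and k': "\<And>i. i < length ss \<Longrightarrow> i \<noteq> k \<Longrightarrow> \<not> isomorphic C r (ss ! i)"
    using isomorphic_obj by (auto simp: iso_class_def)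
  note k1 = d(1,2)[OF k]
  obtain t where t: "\<pi> k \<cdot> T \<cdot> \<iota> k = t \<^bold>* \<ii> (ss ! k)"
    using simple_endo_scalar[of "ss ! k" "\<pi> k \<cdot> T \<cdot> \<iota> k"] sS[of "ss ! k"] k k1 T by auto
  have factor: "\<iota> k \<cdot> (\<pi> k \<cdot> v) = v" if v: "v \<in> Arr C" "isomorphic C r (Dom C v)" "Cod C v = w" for v
  proof (rule direct_sum_single_component[OF dS d v(1,3) k])
    fix i assume i: "i < length ss" "i \<noteq> k"
    have "\<not> isomorphic C (Dom C v) (ss ! i)" using k'[OF i] v(2) isomorphic_trans by blast
    moreover have "simple_object C (Dom C v)" using simple_object_isomorphic[OF v(2) r] .
    moreover have "simple_object C (ss ! i)" using sS i by simp
    ultimately show "\<pi> i \<cdot> v = zero_arr C (Dom C v) (ss ! i)"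
      using simple_hom_zero[of "Dom C v" "ss ! i" "\<pi> i \<cdot> v"] d(2)[OF i(1)] v by simp
  qed
  have "T \<cdot> v = t \<^bold>* v" if v: "v \<in> Arr C" "isomorphic C r (Dom C v)" "Cod C v = w" for v
  proof -
    have ob: "ss ! k \<in> Obj C" using Cod_obj[of "\<pi> k"] k1 by simp
    have "T \<cdot> v = \<iota> k \<cdot> (\<pi> k \<cdot> (T \<cdot> v))" using factor[of "T \<cdot> v"] v T by simp
    also have "\<dots> = \<iota> k \<cdot> (\<pi> k \<cdot> (T \<cdot> (\<iota> k \<cdot> (\<pi> k \<cdot> v))))" using factor[OF v] by simp
    also have "\<dots> = \<iota> k \<cdot> (\<pi> k \<cdot> T \<cdot> \<iota> k \<cdot> (\<pi> k \<cdot> v))" using k1 T v by (simp add: assoc)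
    also have "\<dots> = t \<^bold>* (\<iota> k \<cdot> (\<pi> k \<cdot> v))" unfolding t using k1 ob v by simp
    finally show ?thesis using factor[OF v] by simp
  qed
  then show ?thesis by blast
qed

lemma projection_detects_simple:
  assumes s: "simple_object C s" and v: "v \<in> Arr C" "Dom C v = s" "Cod C v = w" "v \<noteq> zero_arr C s w"
  shows "\<exists>\<pi>. \<pi> \<in> Arr C \<and> Dom C \<pi> = w \<and> simple_object C (Cod C \<pi>) \<and> iso_arrow C (\<pi> \<cdot> v)"
proof -
  have w: "w \<in> Obj C" using v by auto
  obtain ss where dec: "simple_decomposition C w ss" using semisimple[OF w] by blast
  then have dS: "direct_sum C w ss" and sS: "\<And>s. s \<in> set ss \<Longrightarrow> simple_object C s"
    by (auto simp: simple_decomposition_def)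
  obtain \<iota> \<pi> where
    d: "\<And>i. i < length ss \<Longrightarrow> \<iota> i \<in> Arr C \<and> Dom C (\<iota> i) = ss ! i \<and> Cod C (\<iota> i) = w"
      "\<And>i. i < length ss \<Longrightarrow> \<pi> i \<in> Arr C \<and> Dom C (\<pi> i) = w \<and> Cod C (\<pi> i) = ss ! i"
      "\<And>f g. f \<in> Arr C \<Longrightarrow> g \<in> Arr C \<Longrightarrow> Cod C f = w \<Longrightarrow> Dom C g = w \<Longrightarrow>
        g \<cdot> f = finsum (hom_space C (Dom C f) (Cod C g)) (\<lambda>i. g \<cdot> (\<iota> i \<cdot> \<pi> i) \<cdot> f) {..<length ss}"
    using dS by (rule direct_sumE) blast
  have sO: "s \<in> Obj C" using s by (simp add: simple_object_def)
  have "\<exists>i<length ss. \<pi> i \<cdot> v \<noteq> zero_arr C s (ss ! i)"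
  proof (rule ccontr)
    assume "\<not> (\<exists>i<length ss. \<pi> i \<cdot> v \<noteq> zero_arr C s (ss ! i))"
    then have z: "\<And>i. i < length ss \<Longrightarrow> \<pi> i \<cdot> v = zero_arr C s (ss ! i)" by blast
    have "v = finsum (hom_space C s w) (\<lambda>i. \<ii> w \<cdot> (\<iota> i \<cdot> \<pi> i) \<cdot> v) {..<length ss}"
      using d(3)[of v "\<ii> w"] v w by simp
    also have "\<dots> = finsum (hom_space C s w) (\<lambda>i. 0 \<^bold>* v) {..<length ss}"
    proof (rule hom_sum_cong)
      fix i assume "i \<in> {..<length ss}"
      then have i: "i < length ss" by simp
      show "\<ii> w \<cdot> (\<iota> i \<cdot> \<pi> i) \<cdot> v = 0 \<^bold>* v"
        using d(1,2)[OF i] z[OF i] v w sO by (simp add: assoc)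
    qed (use v w sO in \<open>auto simp: Hom_iff\<close>)
    also have "\<dots> = (\<Sum>i<length ss. 0) \<^bold>* v" using v by (intro hom_sum_scale) (auto simp: Hom_iff)
    also have "\<dots> = zero_arr C s w" using v by simp
    finally show False using v by simp
  qed
  then obtain i where i: "i < length ss" "\<pi> i \<cdot> v \<noteq> zero_arr C s (ss ! i)" by blast
  have "iso_arrow C (\<pi> i \<cdot> v)"
    using simple_nonzero_iso[OF s, of "ss ! i" "\<pi> i \<cdot> v"] sS[of "ss ! i"] i v d(2)[OF i(1)] by simp
  then show ?thesis using d(2)[OF i(1)] sS[of "ss ! i"] i by auto
qed

end

section \<open>Tensor calculus\<close>

context tensor_category
begin

declare unit_closed [simp] tensor_obj_closed [simp] tensor_id [simp]

lemma arr_tensor [simp]: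
  assumes "f \<in> Arr C" "g \<in> Arr C"
  shows "f \<boxtimes> g \<in> Arr C" "Dom C (f \<boxtimes> g) = Dom C f \<boxdot> Dom C g" "Cod C (f \<boxtimes> g) = Cod C f \<boxdot> Cod C g"
  using tensor_arr_closed[of f "Dom C f" "Cod C f" g "Dom C g" "Cod C g"] assms
  by (simp_all add: Hom_iff)

lemma arr_associator [simp]:
  assumes "a \<in> Obj C" "b \<in> Obj C" "c \<in> Obj C"
  shows "\<a> a b c \<in> Arr C" "Dom C (\<a> a b c) = a \<boxdot> b \<boxdot> c" "Cod C (\<a> a b c) = a \<boxdot> (b \<boxdot> c)"
  using associator_closed[OF assms] by (simp_all add: Hom_iff)

lemma tensor_merge:
  "\<lbrakk>f \<in> Arr C; g \<in> Arr C; f' \<in> Arr C; g' \<in> Arr C; Dom C g = Cod C f; Dom C g' = Cod C f'\<rbrakk> \<Longrightarrow>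
    (g \<boxtimes> g') \<cdot> (f \<boxtimes> f') = (g \<cdot> f) \<boxtimes> (g' \<cdot> f')"
  by (rule tensor_comp[symmetric]) (auto simp: Hom_iff)

lemma associator_nat:
  "\<lbrakk>f \<in> Arr C; g \<in> Arr C; h \<in> Arr C\<rbrakk> \<Longrightarrow>
    \<a> (Cod C f) (Cod C g) (Cod C h) \<cdot> (f \<boxtimes> g \<boxtimes> h) =
    (f \<boxtimes> (g \<boxtimes> h)) \<cdot> \<a> (Dom C f) (Dom C g) (Dom C h)"
  by (rule associator_natural) (auto simp: Hom_iff)

lemma tensor_scale [simp]:
  assumes "f \<in> Arr C" "g \<in> Arr C"
  shows "t \<^bold>* f \<boxtimes> g = t \<^bold>* (f \<boxtimes> g)" "f \<boxtimes> (t \<^bold>* g) = t \<^bold>* (f \<boxtimes> g)"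
  using tensor_scale_left[of f "Dom C f" "Cod C f" g "Dom C g" "Cod C g"]
    tensor_scale_right[of f "Dom C f" "Cod C f" g "Dom C g" "Cod C g"] assms
  by (simp_all add: Hom_iff)

lemma tensor_zero [simp]:
  assumes "f \<in> Arr C" "b \<in> Obj C" "c \<in> Obj C"
  shows "f \<boxtimes> zero_arr C b c = zero_arr C (Dom C f \<boxdot> b) (Cod C f \<boxdot> c)"
proof -
  have "f \<boxtimes> zero_arr C b c = f \<boxtimes> (0 \<^bold>* zero_arr C b c)" using assms by simp
  also have "\<dots> = 0 \<^bold>* (f \<boxtimes> zero_arr C b c)" using assms by (subst tensor_scale) simp_all
  finally show ?thesis using assms by simp
qed

lemma iso_arrow_tensor:
  assumes "iso_arrow C f" "iso_arrow C g"
  shows "iso_arrow C (f \<boxtimes> g)"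
proof -
  obtain f' where f': "f \<in> Arr C" "f' \<in> Arr C" "Dom C f' = Cod C f" "Cod C f' = Dom C f"
    "f' \<cdot> f = \<ii> (Dom C f)" "f \<cdot> f' = \<ii> (Cod C f)" using assms(1) by (rule iso_arrowE)
  obtain g' where g': "g \<in> Arr C" "g' \<in> Arr C" "Dom C g' = Cod C g" "Cod C g' = Dom C g"
    "g' \<cdot> g = \<ii> (Dom C g)" "g \<cdot> g' = \<ii> (Cod C g)" using assms(2) by (rule iso_arrowE)
  show ?thesis
    by (rule iso_arrowI[where g = "f' \<boxtimes> g'"]) (use f' g' in \<open>simp_all add: tensor_merge\<close>)
qed

lemma isomorphic_tensor:
  assumes "isomorphic C a a'" "isomorphic C b b'"
  shows "isomorphic C (a \<boxdot> b) (a' \<boxdot> b')"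
proof -
  obtain f where f: "iso_arrow C f" "f \<in> Arr C" "Dom C f = a" "Cod C f = a'"
    using assms(1) by (rule isomorphicE)
  obtain g where g: "iso_arrow C g" "g \<in> Arr C" "Dom C g = b" "Cod C g = b'"
    using assms(2) by (rule isomorphicE)
  show ?thesis by (rule isomorphicI[OF iso_arrow_tensor[OF f(1) g(1)]]) (use f g in simp_all)
qed

lemma isomorphic_tensor_unit: "a \<in> Obj C \<Longrightarrow> isomorphic C (a \<boxdot> \<I>) a"
  using right_unitor_iso[of a] right_unitor_closed[of a] by (auto intro: isomorphicI simp: Hom_iff)

text \<open>
  Tensoring with \<open>x\<close> is undone by tensoring with \<open>y\<close>.
\<close>

lemma tensor_left_faithful:
  assumes inv: "isomorphic C (y \<boxdot> x) \<I>" and ob: "x \<in> Obj C" "y \<in> Obj C"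
    and v: "v \<in> Arr C" and z: "\<ii> x \<boxtimes> v = zero_arr C (x \<boxdot> Dom C v) (x \<boxdot> Cod C v)"
  shows "v = zero_arr C (Dom C v) (Cod C v)"
proof -
  let ?a = "Dom C v" and ?b = "Cod C v"
  have ab: "?a \<in> Obj C" "?b \<in> Obj C" using v by auto
  have "\<a> y x ?b \<cdot> (\<ii> (y \<boxdot> x) \<boxtimes> v) = (\<ii> y \<boxtimes> (\<ii> x \<boxtimes> v)) \<cdot> \<a> y x ?a"
    using associator_nat[of "\<ii> y" "\<ii> x" v] ob v by simp
  also have "\<dots> = zero_arr C (y \<boxdot> x \<boxdot> ?a) (y \<boxdot> (x \<boxdot> ?b))"
    unfolding z using ob ab by simp
  finally have 1: "\<ii> (y \<boxdot> x) \<boxtimes> v = zero_arr C (y \<boxdot> x \<boxdot> ?a) (y \<boxdot> x \<boxdot> ?b)"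
    using iso_comp_zero_cancel(1)[OF associator_iso[of y x ?b], of "\<ii> (y \<boxdot> x) \<boxtimes> v"] ob ab v by simp
  obtain \<phi> where f: "iso_arrow C \<phi>" "\<phi> \<in> Arr C" "Dom C \<phi> = y \<boxdot> x" "Cod C \<phi> = \<I>"
    using inv by (rule isomorphicE)
  have "(\<ii> \<I> \<boxtimes> v) \<cdot> (\<phi> \<boxtimes> \<ii> ?a) = (\<phi> \<boxtimes> \<ii> ?b) \<cdot> (\<ii> (y \<boxdot> x) \<boxtimes> v)"
    using f v ab ob by (simp add: tensor_merge)
  also have "\<dots> = zero_arr C (y \<boxdot> x \<boxdot> ?a) (\<I> \<boxdot> ?b)" unfolding 1 using f ab ob by simp
  finally have 2: "\<ii> \<I> \<boxtimes> v = zero_arr C (\<I> \<boxdot> ?a) (\<I> \<boxdot> ?b)"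
    using iso_comp_zero_cancel(2)[OF iso_arrow_tensor[OF f(1) iso_arrow_id[OF ab(1)]], of "\<ii> \<I> \<boxtimes> v"]
      f ab v by simp
  have l: "\<l> ?a \<in> Arr C \<and> Dom C (\<l> ?a) = \<I> \<boxdot> ?a \<and> Cod C (\<l> ?a) = ?a"
    "\<l> ?b \<in> Arr C \<and> Dom C (\<l> ?b) = \<I> \<boxdot> ?b \<and> Cod C (\<l> ?b) = ?b"
    using left_unitor_closed ab by (simp_all add: Hom_iff)
  have "v \<cdot> \<l> ?a = zero_arr C (\<I> \<boxdot> ?a) ?b"
    using left_unitor_natural[of v ?a ?b] 2 v l ab by (simp add: Hom_iff)
  then show ?thesis using iso_comp_zero_cancel(2)[OF left_unitor_iso[of ?a], of v] l v ab by simp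
qed

text \<open>
  The right coaction \<open>f: p \<rightarrow> p \<boxdot> x\<close> emits a copy of \<open>x\<close>, which the left action
  \<open>g: x \<boxdot> w \<rightarrow> w\<close> absorbs.
\<close>

definition middle_twist :: "'o \<Rightarrow> 'o \<Rightarrow> 'o \<Rightarrow> 'm \<Rightarrow> 'm \<Rightarrow> 'm" where
  "middle_twist p x w f g = (\<ii> p \<boxtimes> g) \<cdot> (\<a> p x w \<cdot> (f \<boxtimes> \<ii> w))"

context
  fixes p x f
  assumes px: "p \<in> Obj C" "x \<in> Obj C" and f: "f \<in> Arr C" "Dom C f = p" "Cod C f = p \<boxdot> x"
begin

lemma arr_middle_twist:
  assumes "w \<in> Obj C" "g \<in> Arr C" "Dom C g = x \<boxdot> w" "Cod C g = w"
  shows "middle_twist p x w f g \<in> Arr C" "Dom C (middle_twist p x w f g) = p \<boxdot> w"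
    "Cod C (middle_twist p x w f g) = p \<boxdot> w"
  using px f assms by (simp_all add: middle_twist_def)

text \<open>
  On \<open>p \<boxdot> v\<close> the twist applies the action to \<open>v\<close>, up to an arrow that depends only on the source of \<open>v\<close>.
  This follows from naturality alone.
\<close>

lemma middle_twist_whisker:
  assumes R: "R \<in> Arr C" "Dom C R = x \<boxdot> w" "Cod C R = w" and v: "v \<in> Arr C" "Cod C v = w"
  shows "middle_twist p x w f R \<cdot> (\<ii> p \<boxtimes> v) =
    (\<ii> p \<boxtimes> (R \<cdot> (\<ii> x \<boxtimes> v))) \<cdot> (\<a> p x (Dom C v) \<cdot> (f \<boxtimes> \<ii> (Dom C v)))"
proof -
  let ?V = "Dom C v"
  have ob: "w \<in> Obj C" "?V \<in> Obj C" using v by auto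
  have 1: "(f \<boxtimes> \<ii> w) \<cdot> (\<ii> p \<boxtimes> v) = (\<ii> (p \<boxdot> x) \<boxtimes> v) \<cdot> (f \<boxtimes> \<ii> ?V)"
    using px f v ob by (simp add: tensor_merge)
  have 2: "\<a> p x w \<cdot> (\<ii> (p \<boxdot> x) \<boxtimes> v) = (\<ii> p \<boxtimes> (\<ii> x \<boxtimes> v)) \<cdot> \<a> p x ?V"
    using associator_nat[of "\<ii> p" "\<ii> x" v] px v by simp
  have "middle_twist p x w f R \<cdot> (\<ii> p \<boxtimes> v) =
      (\<ii> p \<boxtimes> R) \<cdot> (\<a> p x w \<cdot> ((f \<boxtimes> \<ii> w) \<cdot> (\<ii> p \<boxtimes> v)))"
    unfolding middle_twist_def using px f R v ob by (simp add: assoc)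
  also have "\<dots> = (\<ii> p \<boxtimes> R) \<cdot> (\<a> p x w \<cdot> (\<ii> (p \<boxdot> x) \<boxtimes> v) \<cdot> (f \<boxtimes> \<ii> ?V))"
    unfolding 1 using px f R v ob by (simp add: assoc)
  also have "\<dots> = (\<ii> p \<boxtimes> R) \<cdot> (\<ii> p \<boxtimes> (\<ii> x \<boxtimes> v)) \<cdot> (\<a> p x ?V \<cdot> (f \<boxtimes> \<ii> ?V))"
    unfolding 2 using px f R v ob by (simp add: assoc)
  also have "(\<ii> p \<boxtimes> R) \<cdot> (\<ii> p \<boxtimes> (\<ii> x \<boxtimes> v)) = \<ii> p \<boxtimes> (R \<cdot> (\<ii> x \<boxtimes> v))"
    using px f R v ob by (simp add: tensor_merge)
  finally show ?thesis .
qed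

text \<open>
  The twist happens between \<open>p\<close> and \<open>q\<close>, so a further factor \<open>r\<close> on the right only changes the action of
  \<open>x\<close> on \<open>q\<close> into the induced action \<open>R\<close> on \<open>q \<boxdot> r\<close>.  The pentagon for \<open>p, x, q, r\<close> moves the brackets.
\<close>

lemma middle_twist_tensor:
  assumes ob: "q \<in> Obj C" "r \<in> Obj C" and g: "g \<in> Arr C" "Dom C g = x \<boxdot> q" "Cod C g = q"
    and R: "R \<in> Arr C" "Dom C R = x \<boxdot> (q \<boxdot> r)" "Cod C R = q \<boxdot> r"
    and Rg: "R \<cdot> \<a> x q r = g \<boxtimes> \<ii> r"
  shows "\<a> p q r \<cdot> (middle_twist p x q f g \<boxtimes> \<ii> r) = middle_twist p x (q \<boxdot> r) f R \<cdot> \<a> p q r"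
proof -
  have 1: "middle_twist p x q f g \<boxtimes> \<ii> r =
      (\<ii> p \<boxtimes> g \<boxtimes> \<ii> r) \<cdot> ((\<a> p x q \<boxtimes> \<ii> r) \<cdot> (f \<boxtimes> \<ii> q \<boxtimes> \<ii> r))"
    unfolding middle_twist_def using px f g ob by (simp add: tensor_merge)
  have 2: "\<a> p q r \<cdot> (\<ii> p \<boxtimes> g \<boxtimes> \<ii> r) = (\<ii> p \<boxtimes> (g \<boxtimes> \<ii> r)) \<cdot> \<a> p (x \<boxdot> q) r"
    using associator_nat[of "\<ii> p" g "\<ii> r"] px g ob by simp
  have 3: "\<ii> p \<boxtimes> (g \<boxtimes> \<ii> r) = (\<ii> p \<boxtimes> R) \<cdot> (\<ii> p \<boxtimes> \<a> x q r)"
    using px R ob Rg by (simp add: tensor_merge)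
  have 4: "\<a> (p \<boxdot> x) q r \<cdot> (f \<boxtimes> \<ii> q \<boxtimes> \<ii> r) = (f \<boxtimes> \<ii> (q \<boxdot> r)) \<cdot> \<a> p q r"
    using associator_nat[of f "\<ii> q" "\<ii> r"] f ob by simp
  have "\<a> p q r \<cdot> (middle_twist p x q f g \<boxtimes> \<ii> r) =
      \<a> p q r \<cdot> (\<ii> p \<boxtimes> g \<boxtimes> \<ii> r) \<cdot> ((\<a> p x q \<boxtimes> \<ii> r) \<cdot> (f \<boxtimes> \<ii> q \<boxtimes> \<ii> r))"
    unfolding 1 using px f g ob by (simp add: assoc)
  also have "\<dots> = (\<ii> p \<boxtimes> R) \<cdot> ((\<ii> p \<boxtimes> \<a> x q r) \<cdot> \<a> p (x \<boxdot> q) r \<cdot> (\<a> p x q \<boxtimes> \<ii> r) \<cdot> (f \<boxtimes> \<ii> q \<boxtimes> \<ii> r))"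
    unfolding 2 3 using px f R ob by (simp add: assoc)
  also have "(\<ii> p \<boxtimes> \<a> x q r) \<cdot> \<a> p (x \<boxdot> q) r \<cdot> (\<a> p x q \<boxtimes> \<ii> r) = \<a> p x (q \<boxdot> r) \<cdot> \<a> (p \<boxdot> x) q r"
    using pentagon[of p x q r] px ob by simp
  also have "(\<ii> p \<boxtimes> R) \<cdot> (\<a> p x (q \<boxdot> r) \<cdot> \<a> (p \<boxdot> x) q r \<cdot> (f \<boxtimes> \<ii> q \<boxtimes> \<ii> r)) =
      (\<ii> p \<boxtimes> R) \<cdot> (\<a> p x (q \<boxdot> r) \<cdot> (\<a> (p \<boxdot> x) q r \<cdot> (f \<boxtimes> \<ii> q \<boxtimes> \<ii> r)))"
    using px f R ob by (simp add: assoc)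
  also have "\<dots> = middle_twist p x (q \<boxdot> r) f R \<cdot> \<a> p q r"
    unfolding 4 middle_twist_def using px f R ob by (simp add: assoc)
  finally show ?thesis .
qed

text \<open>
  The twist and the left coaction \<open>l\<close> of \<open>x\<close> on \<open>p\<close> touch opposite sides of \<open>p\<close>; they interact only
  through the scalar \<open>b\<close> in the comparison of \<open>l\<close> with \<open>f\<close>.  The pentagon for \<open>x, p, x, q\<close> moves the
  brackets.
\<close>

lemma middle_twist_left_action:
  assumes q: "q \<in> Obj C" and g: "g \<in> Arr C" "Dom C g = x \<boxdot> q" "Cod C g = q"
    and l: "l \<in> Arr C" "Dom C l = p" "Cod C l = x \<boxdot> p"
    and b: "\<a> x p x \<cdot> ((l \<boxtimes> \<ii> x) \<cdot> f) = b \<^bold>* ((\<ii> x \<boxtimes> f) \<cdot> l)"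
  shows "\<a> x p q \<cdot> (l \<boxtimes> \<ii> q) \<cdot> middle_twist p x q f g =
    b \<^bold>* ((\<ii> x \<boxtimes> middle_twist p x q f g) \<cdot> (\<a> x p q \<cdot> (l \<boxtimes> \<ii> q)))"
proof -
  have 1: "(l \<boxtimes> \<ii> q) \<cdot> (\<ii> p \<boxtimes> g) = (\<ii> (x \<boxdot> p) \<boxtimes> g) \<cdot> (l \<boxtimes> \<ii> (x \<boxdot> q))"
    using px q g l by (simp add: tensor_merge)
  have 2: "\<a> x p q \<cdot> (\<ii> (x \<boxdot> p) \<boxtimes> g) = (\<ii> x \<boxtimes> (\<ii> p \<boxtimes> g)) \<cdot> \<a> x p (x \<boxdot> q)"
    using associator_nat[of "\<ii> x" "\<ii> p" g] px q g by simp
  have 3: "(l \<boxtimes> \<ii> (x \<boxdot> q)) \<cdot> \<a> p x q = \<a> (x \<boxdot> p) x q \<cdot> (l \<boxtimes> \<ii> x \<boxtimes> \<ii> q)"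
    using associator_nat[of l "\<ii> x" "\<ii> q"] px q l by simp
  have 4: "(\<a> x p x \<boxtimes> \<ii> q) \<cdot> ((l \<boxtimes> \<ii> x \<boxtimes> \<ii> q) \<cdot> (f \<boxtimes> \<ii> q)) = b \<^bold>* (((\<ii> x \<boxtimes> f) \<cdot> l) \<boxtimes> \<ii> q)"
    using px q l f b by (simp add: tensor_merge)
  have 5: "((\<ii> x \<boxtimes> f) \<cdot> l) \<boxtimes> \<ii> q = (\<ii> x \<boxtimes> f \<boxtimes> \<ii> q) \<cdot> (l \<boxtimes> \<ii> q)"
    using px q l f by (simp add: tensor_merge)
  have 6: "\<a> x (p \<boxdot> x) q \<cdot> (\<ii> x \<boxtimes> f \<boxtimes> \<ii> q) = (\<ii> x \<boxtimes> (f \<boxtimes> \<ii> q)) \<cdot> \<a> x p q"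
    using associator_nat[of "\<ii> x" f "\<ii> q"] px q f by simp
  have 7: "\<ii> x \<boxtimes> middle_twist p x q f g =
      (\<ii> x \<boxtimes> (\<ii> p \<boxtimes> g)) \<cdot> ((\<ii> x \<boxtimes> \<a> p x q) \<cdot> (\<ii> x \<boxtimes> (f \<boxtimes> \<ii> q)))"
    unfolding middle_twist_def using px q f g by (simp add: tensor_merge)
  have "\<a> x p q \<cdot> (l \<boxtimes> \<ii> q) \<cdot> middle_twist p x q f g =
      \<a> x p q \<cdot> ((l \<boxtimes> \<ii> q) \<cdot> (\<ii> p \<boxtimes> g) \<cdot> (\<a> p x q \<cdot> (f \<boxtimes> \<ii> q)))"
    unfolding middle_twist_def using px q f g l by (simp add: assoc)
  also have "\<dots> = \<a> x p q \<cdot> (\<ii> (x \<boxdot> p) \<boxtimes> g) \<cdot> ((l \<boxtimes> \<ii> (x \<boxdot> q)) \<cdot> \<a> p x q \<cdot> (f \<boxtimes> \<ii> q))"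
    unfolding 1 using px q f g l by (simp add: assoc)
  also have "\<dots> = (\<ii> x \<boxtimes> (\<ii> p \<boxtimes> g)) \<cdot> (\<a> x p (x \<boxdot> q) \<cdot> \<a> (x \<boxdot> p) x q \<cdot> ((l \<boxtimes> \<ii> x \<boxtimes> \<ii> q) \<cdot> (f \<boxtimes> \<ii> q)))"
    unfolding 2 3 using px q f g l by (simp add: assoc)
  also have "\<a> x p (x \<boxdot> q) \<cdot> \<a> (x \<boxdot> p) x q =
      (\<ii> x \<boxtimes> \<a> p x q) \<cdot> \<a> x (p \<boxdot> x) q \<cdot> (\<a> x p x \<boxtimes> \<ii> q)"
    using pentagon[of x p x q] px q by simp
  also have "(\<ii> x \<boxtimes> (\<ii> p \<boxtimes> g)) \<cdot> ((\<ii> x \<boxtimes> \<a> p x q) \<cdot> \<a> x (p \<boxdot> x) q \<cdot> (\<a> x p x \<boxtimes> \<ii> q) \<cdot>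
        ((l \<boxtimes> \<ii> x \<boxtimes> \<ii> q) \<cdot> (f \<boxtimes> \<ii> q))) =
      (\<ii> x \<boxtimes> (\<ii> p \<boxtimes> g)) \<cdot> ((\<ii> x \<boxtimes> \<a> p x q) \<cdot> (\<a> x (p \<boxdot> x) q \<cdot>
        ((\<a> x p x \<boxtimes> \<ii> q) \<cdot> ((l \<boxtimes> \<ii> x \<boxtimes> \<ii> q) \<cdot> (f \<boxtimes> \<ii> q)))))"
    using px q f g l by (simp add: assoc)
  also have "\<dots> = b \<^bold>* ((\<ii> x \<boxtimes> (\<ii> p \<boxtimes> g)) \<cdot> ((\<ii> x \<boxtimes> \<a> p x q) \<cdot>
      (\<a> x (p \<boxdot> x) q \<cdot> (\<ii> x \<boxtimes> f \<boxtimes> \<ii> q) \<cdot> (l \<boxtimes> \<ii> q))))"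
    unfolding 4 5 using px q f g l by (simp add: assoc)
  also have "\<dots> = b \<^bold>* ((\<ii> x \<boxtimes> middle_twist p x q f g) \<cdot> (\<a> x p q \<cdot> (l \<boxtimes> \<ii> q)))"
    unfolding 6 7 using px q f g l by (simp add: assoc)
  finally show ?thesis .
qed

end

end

section \<open>The contradiction\<close>

context fusion_category
begin

lemma iso_middle_twist:
  assumes ob: "p \<in> Obj C" "x \<in> Obj C" "w \<in> Obj C"
    and f: "iso_arrow C f" "Dom C f = p" "Cod C f = p \<boxdot> x"
    and g: "iso_arrow C g" "Dom C g = x \<boxdot> w" "Cod C g = w"
  shows "iso_arrow C (middle_twist p x w f g)"
  unfolding middle_twist_def
  by (intro iso_arrow_comp iso_arrow_tensor iso_arrow_id associator_iso)
    (use ob f g iso_arrow_arr[OF f(1)] iso_arrow_arr[OF g(1)] in simp_all)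

text \<open>
  The heart of the matter: the middle twist \<open>T\<close> of \<open>p \<boxdot> q\<close> satisfies a quadratic equation because it has
  at most two eigenvalues, and cannot satisfy one because its first three powers reach non-isomorphic
  simple objects.
\<close>

lemma no_compatible_fusion_rules:
  assumes sp: "simple_object C p" and sq: "simple_object C q" and sx: "simple_object C x"
    and sy: "simple_object C y" and sz: "simple_object C z"
    and yx: "isomorphic C (y \<boxdot> x) \<I>" and xx: "isomorphic C (x \<boxdot> x) y"
    and xz: "isomorphic C (x \<boxdot> z) z"
    and xp: "isomorphic C (x \<boxdot> p) p" and px: "isomorphic C (p \<boxdot> x) p"
    and xq: "isomorphic C (x \<boxdot> q) q"
    and Iy: "\<not> isomorphic C \<I> y" and nxy: "\<not> isomorphic C x y"
    and dec: "simple_decomposition C (p \<boxdot> q) ss"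
    and only: "\<And>s. s \<in> set ss \<Longrightarrow> \<exists>r \<in> {\<I>, x, y, z}. isomorphic C r s"
    and once: "\<And>r. r \<in> {\<I>, x, y, z} \<Longrightarrow> length (filter (\<lambda>s. s \<in> iso_class C r) ss) = 1"
    and dec': "simple_decomposition C (q \<boxdot> p) ts" and t0: "t0 \<in> set ts" "isomorphic C \<I> t0"
  shows False
proof -
  have ob: "p \<in> Obj C" "q \<in> Obj C" "x \<in> Obj C" "y \<in> Obj C" "z \<in> Obj C"
    using sp sq sx sy sz by (simp_all add: simple_object_def)
  note sI = unit_simple
  note faithful = tensor_left_faithful[OF yx ob(3,4)]
  obtain f where f: "iso_arrow C f" "f \<in> Arr C" "Dom C f = p" "Cod C f = p \<boxdot> x"
    using isomorphic_sym[OF px] by (rule isomorphicE)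
  obtain l where l: "iso_arrow C l" "l \<in> Arr C" "Dom C l = p" "Cod C l = x \<boxdot> p"
    using isomorphic_sym[OF xp] by (rule isomorphicE)
  obtain g where g: "iso_arrow C g" "g \<in> Arr C" "Dom C g = x \<boxdot> q" "Cod C g = q"
    using xq by (rule isomorphicE)

  define u where "u = (\<ii> x \<boxtimes> f) \<cdot> l"
  have u: "iso_arrow C u" "u \<in> Arr C" "Dom C u = p" "Cod C u = x \<boxdot> (p \<boxdot> x)"
    unfolding u_def using ob f l
    by (auto intro!: iso_arrow_comp iso_arrow_tensor iso_arrow_id)
  have sxpx: "simple_object C (x \<boxdot> (p \<boxdot> x))"
    using simple_object_isomorphic[OF isomorphicI[OF u(1,3,4)] sp] .
  \<comment> \<open>both composites are arrows between the simple objects \<open>p\<close> and \<open>x \<boxdot> (p \<boxdot> x)\<close>\<close>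
  obtain b where b: "\<a> x p x \<cdot> ((l \<boxtimes> \<ii> x) \<cdot> f) = b \<^bold>* u"
    using simple_hom_proportional[OF sp sxpx u(2-4), of "\<a> x p x \<cdot> ((l \<boxtimes> \<ii> x) \<cdot> f)"]
      iso_arrow_nonzero[OF u(1)] sp u ob f l by (auto simp: simple_object_def)

  define T where "T = middle_twist p x q f g"
  note T = arr_middle_twist[OF ob(1,3) f(2-4) ob(2) g(2-4), folded T_def]
  have Tiso: "iso_arrow C T"
    unfolding T_def by (rule iso_middle_twist) (use ob f g in auto)
  define \<Lambda> where "\<Lambda> = \<a> x p q \<cdot> (l \<boxtimes> \<ii> q)"
  have \<Lambda>: "iso_arrow C \<Lambda>" "\<Lambda> \<in> Arr C" "Dom C \<Lambda> = p \<boxdot> q" "Cod C \<Lambda> = x \<boxdot> (p \<boxdot> q)"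
    unfolding \<Lambda>_def using ob l
    by (auto intro!: iso_arrow_comp iso_arrow_tensor iso_arrow_id associator_iso)
  have \<Lambda>T: "\<Lambda> \<cdot> T = b \<^bold>* ((\<ii> x \<boxtimes> T) \<cdot> \<Lambda>)"
    unfolding \<Lambda>_def T_def
    by (rule middle_twist_left_action[OF ob(1,3) f(2-4) ob(2) g(2-4) l(2-4) b[unfolded u_def]])

  \<comment> \<open>tensoring an eigenvector with \<open>x\<close> multiplies its eigenvalue by \<open>b\<close>\<close>
  have shift: "\<exists>w. w \<in> Arr C \<and> Dom C w = x \<boxdot> s \<and> Cod C w = p \<boxdot> q \<and>
      w \<noteq> zero_arr C (x \<boxdot> s) (p \<boxdot> q) \<and> T \<cdot> w = (b * t) \<^bold>* w"
    if v: "v \<in> Arr C" "Dom C v = s" "Cod C v = p \<boxdot> q" "v \<noteq> zero_arr C s (p \<boxdot> q)"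
      and Tv: "T \<cdot> v = t \<^bold>* v" for s t v
  proof -
    obtain k where k: "k \<in> Arr C" "Dom C k = x \<boxdot> (p \<boxdot> q)" "Cod C k = p \<boxdot> q"
      "k \<cdot> \<Lambda> = \<ii> (p \<boxdot> q)" "\<Lambda> \<cdot> k = \<ii> (x \<boxdot> (p \<boxdot> q))"
      using \<Lambda>(1) by (rule iso_arrowE) (use \<Lambda> in auto)
    have sO: "s \<in> Obj C" using v by auto
    let ?w = "k \<cdot> (\<ii> x \<boxtimes> v)"
    have w: "?w \<in> Arr C" "Dom C ?w = x \<boxdot> s" "Cod C ?w = p \<boxdot> q" using k v ob by simp_all
    have \<Lambda>w: "\<Lambda> \<cdot> ?w = \<ii> x \<boxtimes> v"
      using assoc[of "\<ii> x \<boxtimes> v" k \<Lambda>] k \<Lambda> v ob by simp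
    have "\<Lambda> \<cdot> (T \<cdot> ?w) = \<Lambda> \<cdot> T \<cdot> ?w" using w T \<Lambda> by (simp add: assoc)
    also have "\<dots> = b \<^bold>* ((\<ii> x \<boxtimes> T) \<cdot> (\<Lambda> \<cdot> ?w))"
      unfolding \<Lambda>T using w T \<Lambda> ob by (simp add: assoc)
    also have "\<dots> = (b * t) \<^bold>* (\<ii> x \<boxtimes> v)"
      unfolding \<Lambda>w using T v ob Tv by (simp add: tensor_merge)
    finally have "k \<cdot> (\<Lambda> \<cdot> (T \<cdot> ?w)) = (b * t) \<^bold>* ?w" using k v ob by simp
    moreover have "k \<cdot> (\<Lambda> \<cdot> (T \<cdot> ?w)) = T \<cdot> ?w"
      using assoc[of "T \<cdot> ?w" \<Lambda> k] k w T \<Lambda> by simp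
    moreover have "?w \<noteq> zero_arr C (x \<boxdot> s) (p \<boxdot> q)"
    proof
      assume "?w = zero_arr C (x \<boxdot> s) (p \<boxdot> q)"
      then have "\<ii> x \<boxtimes> v = zero_arr C (x \<boxdot> s) (x \<boxdot> (p \<boxdot> q))"
        using \<Lambda>w \<Lambda> ob sO by simp
      then show False using faithful[OF v(1)] v by simp
    qed
    ultimately show ?thesis using w by (intro exI[of _ ?w]) simp
  qed

  have "\<exists>t. \<forall>v \<in> Arr C. isomorphic C r (Dom C v) \<longrightarrow> Cod C v = p \<boxdot> q \<longrightarrow> T \<cdot> v = t \<^bold>* v"
    if "r \<in> {\<I>, x, y, z}" for r
    by (rule isotypic_eigenvalue[OF dec _ once[OF that] T]) (use that sI sx sy sz in auto)
  then obtain t where t: "\<And>r v. \<lbrakk>r \<in> {\<I>, x, y, z}; v \<in> Arr C; isomorphic C r (Dom C v); Cod C v = p \<boxdot> q\<rbrakk>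
      \<Longrightarrow> T \<cdot> v = t r \<^bold>* v"
    by metis
  have t_shift: "t r' = b * t r"
    if r: "r \<in> {\<I>, x, y, z}" "r' \<in> {\<I>, x, y, z}" "isomorphic C (x \<boxdot> r) r'" for r r'
  proof -
    have rO: "r \<in> Obj C" using r ob by auto
    obtain s where s: "s \<in> set ss" "s \<in> iso_class C r"
      using once[OF r(1)] by (metis filter_False list.size(3) zero_neq_one)
    then obtain v where v: "v \<in> Arr C" "Dom C v = r" "Cod C v = p \<boxdot> q" "v \<noteq> zero_arr C r (p \<boxdot> q)"
      using nonzero_arr_from_simple_summand[OF dec s(1), of r] by (auto simp: iso_class_def)
    have "T \<cdot> v = t r \<^bold>* v" using t[OF r(1) v(1)] v isomorphic_refl[OF rO] by simp
    from shift[OF v this] obtain w where w: "w \<in> Arr C" "Dom C w = x \<boxdot> r" "Cod C w = p \<boxdot> q"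
      "w \<noteq> zero_arr C (x \<boxdot> r) (p \<boxdot> q)" "T \<cdot> w = (b * t r) \<^bold>* w" by blast
    moreover have "T \<cdot> w = t r' \<^bold>* w"
      using t[OF r(2) w(1)] w isomorphic_sym[OF r(3)] by simp
    ultimately show ?thesis using scale_cancel[of w "t r'" "b * t r"] by simp
  qed
  have "t z \<noteq> 0"
  proof
    assume t0: "t z = 0"
    obtain s where s: "s \<in> set ss" "s \<in> iso_class C z"
      using once[of z] by (metis filter_False insertCI list.size(3) zero_neq_one)
    then obtain v where v: "v \<in> Arr C" "Dom C v = z" "Cod C v = p \<boxdot> q" "v \<noteq> zero_arr C z (p \<boxdot> q)"
      using nonzero_arr_from_simple_summand[OF dec s(1), of z] by (auto simp: iso_class_def)
    have "T \<cdot> v = zero_arr C z (p \<boxdot> q)"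
      using t[of z v] v isomorphic_refl[OF ob(5)] t0 by simp
    then show False using iso_comp_zero_cancel(1)[OF Tiso v(1)] T v by simp
  qed
  moreover have "t z = b * t z" using t_shift[of z z] xz by simp
  ultimately have b1: "b = 1" by simp
  have tx: "t x = t \<I>" using t_shift[of \<I> x] isomorphic_tensor_unit[OF ob(3)] b1 by simp
  have ty: "t y = t \<I>" using t_shift[of x y] xx b1 tx by simp

  have dS: "direct_sum C (p \<boxdot> q) ss" using dec by (simp add: simple_decomposition_def)
  \<comment> \<open>coefficients of \<open>(T - t \<I>) (T - t z) = 0\<close>\<close>
  define c1 where "c1 = t \<I> + t z"
  define c0 where "c0 = - (t \<I> * t z)"
  have TT: "T \<cdot> T = c1 \<^bold>* T \<^bold>+ c0 \<^bold>* \<ii> (p \<boxdot> q)"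
  proof (rule eq_on_summands[OF dS])
    fix v assume v: "v \<in> Arr C" "Dom C v \<in> set ss" "Cod C v = p \<boxdot> q"
    obtain r where r: "r \<in> {\<I>, x, y, z}" "isomorphic C r (Dom C v)" using only[OF v(2)] by blast
    have Tv: "T \<cdot> v = t r \<^bold>* v" using t[OF r(1) v(1) r(2) v(3)] .
    have "t r * t r = c1 * t r + c0"
      using r(1) tx ty by (auto simp: c1_def c0_def algebra_simps)
    moreover have "T \<cdot> T \<cdot> v = (t r * t r) \<^bold>* v" using T v Tv by (simp add: assoc)
    moreover have "(c1 \<^bold>* T \<^bold>+ c0 \<^bold>* \<ii> (p \<boxdot> q)) \<cdot> v = (c1 * t r + c0) \<^bold>* v"
      using T v ob Tv by (simp add: comp_add_distrib scale_add_left)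
    ultimately show "T \<cdot> T \<cdot> v = (c1 \<^bold>* T \<^bold>+ c0 \<^bold>* \<ii> (p \<boxdot> q)) \<cdot> v" by simp
  qed (use T ob in simp_all)

  obtain k where k: "k \<in> Arr C" "Dom C k = x \<boxdot> (q \<boxdot> p)" "Cod C k = x \<boxdot> q \<boxdot> p"
    "k \<cdot> \<a> x q p = \<ii> (x \<boxdot> q \<boxdot> p)" "\<a> x q p \<cdot> k = \<ii> (x \<boxdot> (q \<boxdot> p))"
    using associator_iso[OF ob(3,2,1)] by (rule iso_arrowE) (use ob in auto)
  define R where "R = (g \<boxtimes> \<ii> p) \<cdot> k"
  have kiso: "iso_arrow C k" by (rule iso_arrowI[where g = "\<a> x q p"]) (use k ob in auto)
  have R: "iso_arrow C R" "R \<in> Arr C" "Dom C R = x \<boxdot> (q \<boxdot> p)" "Cod C R = q \<boxdot> p"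
    unfolding R_def using ob g k kiso
    by (auto intro!: iso_arrow_comp iso_arrow_tensor iso_arrow_id)
  have Rg: "R \<cdot> \<a> x q p = g \<boxtimes> \<ii> p"
    unfolding R_def using ob g k by (simp add: assoc)
  define S where "S = middle_twist p x (q \<boxdot> p) f R"
  have qpO: "q \<boxdot> p \<in> Obj C" using ob by simp
  note S = arr_middle_twist[OF ob(1,3) f(2-4) qpO R(2-4), folded S_def]
  \<comment> \<open>\<open>R\<close> is the action on \<open>q \<boxdot> p\<close> through its first factor, so \<open>T \<boxtimes> \<ii> p\<close> is conjugate to \<open>S\<close>\<close>
  have ST: "\<a> p q p \<cdot> (T \<boxtimes> \<ii> p) = S \<cdot> \<a> p q p"
    unfolding S_def T_def
    by (rule middle_twist_tensor[OF ob(1,3) f(2-4) ob(2,1) g(2-4) R(2-4) Rg])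
  have SS: "S \<cdot> S = c1 \<^bold>* S \<^bold>+ c0 \<^bold>* \<ii> (p \<boxdot> (q \<boxdot> p))"
  proof -
    let ?A = "\<a> p q p"
    obtain m where m: "m \<in> Arr C" "Dom C m = p \<boxdot> (q \<boxdot> p)" "Cod C m = p \<boxdot> q \<boxdot> p"
      "?A \<cdot> m = \<ii> (p \<boxdot> (q \<boxdot> p))"
      using associator_iso[OF ob(1,2,1)] by (rule iso_arrowE) (use ob in auto)
    have "S \<cdot> S \<cdot> ?A = S \<cdot> (?A \<cdot> (T \<boxtimes> \<ii> p))" unfolding ST using S ob by (simp add: assoc)
    also have "\<dots> = S \<cdot> ?A \<cdot> (T \<boxtimes> \<ii> p)" using S T ob by (simp add: assoc)
    also have "\<dots> = ?A \<cdot> ((T \<cdot> T) \<boxtimes> \<ii> p)"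
      unfolding ST[symmetric] using T ob by (simp add: assoc tensor_merge)
    also have "(T \<cdot> T) \<boxtimes> \<ii> p = c1 \<^bold>* (T \<boxtimes> \<ii> p) \<^bold>+ c0 \<^bold>* \<ii> (p \<boxdot> q \<boxdot> p)"
    proof -
      have "(T \<cdot> T) \<boxtimes> \<ii> p = (c1 \<^bold>* T \<boxtimes> \<ii> p) \<^bold>+ (c0 \<^bold>* \<ii> (p \<boxdot> q) \<boxtimes> \<ii> p)"
        unfolding TT using T ob
        by (intro tensor_add_left[of _ "p \<boxdot> q" "p \<boxdot> q" _ _ p p]) (simp_all add: Hom_iff)
      then show ?thesis using T ob by simp
    qed
    also have "?A \<cdot> (c1 \<^bold>* (T \<boxtimes> \<ii> p) \<^bold>+ c0 \<^bold>* \<ii> (p \<boxdot> q \<boxdot> p)) =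
        (c1 \<^bold>* S \<^bold>+ c0 \<^bold>* \<ii> (p \<boxdot> (q \<boxdot> p))) \<cdot> ?A"
      using T S ob ST by (simp add: comp_add_distrib)
    finally have "S \<cdot> S \<cdot> ?A \<cdot> m = (c1 \<^bold>* S \<^bold>+ c0 \<^bold>* \<ii> (p \<boxdot> (q \<boxdot> p))) \<cdot> ?A \<cdot> m" by simp
    then show ?thesis using S m ob by (simp add: assoc)
  qed

  obtain j where j: "j \<in> Arr C" "Dom C j = \<I>" "Cod C j = q \<boxdot> p" "j \<noteq> zero_arr C \<I> (q \<boxdot> p)"
    using nonzero_arr_from_simple_summand[OF dec' t0] by blast
  have R_nonzero: "R \<cdot> (\<ii> x \<boxtimes> v) \<noteq> zero_arr C (x \<boxdot> Dom C v) (q \<boxdot> p)"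
    if v: "v \<in> Arr C" "Cod C v = q \<boxdot> p" "v \<noteq> zero_arr C (Dom C v) (q \<boxdot> p)" for v
    using iso_comp_zero_cancel(1)[OF R(1), of "\<ii> x \<boxtimes> v"] faithful[OF v(1)] R v ob by auto
  define j1 where "j1 = R \<cdot> (\<ii> x \<boxtimes> j)"
  define j2 where "j2 = R \<cdot> (\<ii> x \<boxtimes> j1)"
  have j1: "j1 \<in> Arr C" "Dom C j1 = x \<boxdot> \<I>" "Cod C j1 = q \<boxdot> p" "j1 \<noteq> zero_arr C (x \<boxdot> \<I>) (q \<boxdot> p)"
    using R_nonzero[of j] R j ob unfolding j1_def by auto
  have j2: "j2 \<in> Arr C" "Dom C j2 = x \<boxdot> (x \<boxdot> \<I>)" "Cod C j2 = q \<boxdot> p"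
    "j2 \<noteq> zero_arr C (x \<boxdot> (x \<boxdot> \<I>)) (q \<boxdot> p)"
    using R_nonzero[of j1] R j1 ob unfolding j2_def by auto

  have x1: "isomorphic C (x \<boxdot> \<I>) x" using isomorphic_tensor_unit ob by simp
  have x2: "isomorphic C (x \<boxdot> (x \<boxdot> \<I>)) y"
    using isomorphic_trans[OF isomorphic_tensor[OF isomorphic_refl[OF ob(3)] x1] xx] .
  have sx1: "simple_object C (x \<boxdot> \<I>)" using simple_object_isomorphic[OF isomorphic_sym[OF x1] sx] .
  have sx2: "simple_object C (x \<boxdot> (x \<boxdot> \<I>))" using simple_object_isomorphic[OF isomorphic_sym[OF x2] sy] .
  \<comment> \<open>\<open>\<pi>\<close> separates \<open>j2\<close> from \<open>j\<close> and \<open>j1\<close>\<close>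
  obtain \<pi> where \<pi>: "\<pi> \<in> Arr C" "Dom C \<pi> = q \<boxdot> p" "simple_object C (Cod C \<pi>)" "iso_arrow C (\<pi> \<cdot> j2)"
    using projection_detects_simple[OF sx2 j2] by blast
  have "isomorphic C (x \<boxdot> (x \<boxdot> \<I>)) (Cod C \<pi>)"
    by (rule isomorphicI[OF \<pi>(4)]) (use \<pi> j2 in simp_all)
  then have ty': "isomorphic C (Cod C \<pi>) y" using x2 isomorphic_trans isomorphic_sym by blast
  have \<pi>j: "\<pi> \<cdot> j = zero_arr C \<I> (Cod C \<pi>)"
    by (rule simple_hom_zero[OF sI \<pi>(3)]) (use Iy ty' isomorphic_trans j \<pi> in \<open>auto 0 3\<close>)
  have "\<not> isomorphic C (x \<boxdot> \<I>) (Cod C \<pi>)"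
    using nxy ty' x1 isomorphic_trans isomorphic_sym by blast
  then have \<pi>j1: "\<pi> \<cdot> j1 = zero_arr C (x \<boxdot> \<I>) (Cod C \<pi>)"
    by (rule simple_hom_zero[OF sx1 \<pi>(3)]) (use j1 \<pi> in auto)

  define \<tau> where "\<tau> v = \<a> p x v \<cdot> (f \<boxtimes> \<ii> v)" for v
  have \<tau>: "iso_arrow C (\<tau> v)" "\<tau> v \<in> Arr C" "Dom C (\<tau> v) = p \<boxdot> v" "Cod C (\<tau> v) = p \<boxdot> (x \<boxdot> v)"
    if "v \<in> Obj C" for v
    unfolding \<tau>_def using that ob f
    by (auto intro!: iso_arrow_comp iso_arrow_tensor iso_arrow_id associator_iso)
  note whisker = middle_twist_whisker[OF ob(1,3) f(2-4) R(2-4), folded S_def \<tau>_def]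
  have xI: "x \<boxdot> \<I> \<in> Obj C" using ob by simp
  note \<tau>0 = \<tau>[OF unit_closed] and \<tau>1 = \<tau>[OF xI]
  have S1: "S \<cdot> (\<ii> p \<boxtimes> j) = (\<ii> p \<boxtimes> j1) \<cdot> \<tau> \<I>"
    using whisker[OF j(1,3)] j by (simp add: j1_def)
  have S2: "S \<cdot> (\<ii> p \<boxtimes> j1) = (\<ii> p \<boxtimes> j2) \<cdot> \<tau> (x \<boxdot> \<I>)"
    using whisker[OF j1(1,3)] j1 by (simp add: j2_def)
  let ?c = "Cod C \<pi>"
  have cO: "?c \<in> Obj C" using \<pi> by simp
  have "S \<cdot> S \<cdot> (\<ii> p \<boxtimes> j) = S \<cdot> (\<ii> p \<boxtimes> j1) \<cdot> \<tau> \<I>"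
    using S1 S j j1 ob \<tau>0 by (simp add: assoc)
  also have "\<dots> = (\<ii> p \<boxtimes> j2) \<cdot> (\<tau> (x \<boxdot> \<I>) \<cdot> \<tau> \<I>)"
    unfolding S2 using j2 ob \<tau>0 \<tau>1 by (simp add: assoc)
  finally have "(\<ii> p \<boxtimes> \<pi>) \<cdot> (S \<cdot> S \<cdot> (\<ii> p \<boxtimes> j)) = (\<ii> p \<boxtimes> (\<pi> \<cdot> j2)) \<cdot> (\<tau> (x \<boxdot> \<I>) \<cdot> \<tau> \<I>)"
    using assoc[of "\<tau> (x \<boxdot> \<I>) \<cdot> \<tau> \<I>" "\<ii> p \<boxtimes> j2" "\<ii> p \<boxtimes> \<pi>"] j2 \<pi> ob \<tau>0 \<tau>1
    by (simp add: tensor_merge)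
  moreover have "(\<ii> p \<boxtimes> \<pi>) \<cdot> (S \<cdot> S \<cdot> (\<ii> p \<boxtimes> j)) = zero_arr C (p \<boxdot> \<I>) (p \<boxdot> ?c)"
  proof -
    have "S \<cdot> S \<cdot> (\<ii> p \<boxtimes> j) = c1 \<^bold>* ((\<ii> p \<boxtimes> j1) \<cdot> \<tau> \<I>) \<^bold>+ c0 \<^bold>* (\<ii> p \<boxtimes> j)"
      unfolding SS using S j j1 ob S1 by (simp add: comp_add_distrib)
    then have "(\<ii> p \<boxtimes> \<pi>) \<cdot> (S \<cdot> S \<cdot> (\<ii> p \<boxtimes> j)) =
        c1 \<^bold>* ((\<ii> p \<boxtimes> \<pi>) \<cdot> (\<ii> p \<boxtimes> j1) \<cdot> \<tau> \<I>) \<^bold>+ c0 \<^bold>* ((\<ii> p \<boxtimes> \<pi>) \<cdot> (\<ii> p \<boxtimes> j))"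
      using j j1 \<pi> ob \<tau>0 by (simp add: comp_add_distrib assoc)
    also have "\<dots> = zero_arr C (p \<boxdot> \<I>) (p \<boxdot> ?c)"
      using j j1 \<pi> ob \<tau>0 \<pi>j \<pi>j1 cO add_zero[of "zero_arr C (p \<boxdot> \<I>) (p \<boxdot> ?c)" "zero_arr C (p \<boxdot> \<I>) (p \<boxdot> ?c)"]
      by (simp add: tensor_merge)
    finally show ?thesis .
  qed
  moreover have "iso_arrow C ((\<ii> p \<boxtimes> (\<pi> \<cdot> j2)) \<cdot> (\<tau> (x \<boxdot> \<I>) \<cdot> \<tau> \<I>))"
    using iso_arrow_comp[OF iso_arrow_comp[OF \<tau>0(1) \<tau>1(1)] iso_arrow_tensor[OF iso_arrow_id[OF ob(1)] \<pi>(4)]]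
      \<pi> j2 ob \<tau>0 \<tau>1 by simp
  moreover have "\<not> zero_object C (p \<boxdot> \<I>)"
    using zero_object_isomorphic[OF isomorphic_tensor_unit[OF ob(1)]] sp by (auto simp: simple_object_def)
  ultimately show False
    using iso_arrow_nonzero[of "(\<ii> p \<boxtimes> (\<pi> \<cdot> j2)) \<cdot> (\<tau> (x \<boxdot> \<I>) \<cdot> \<tau> \<I>)"] \<pi> j2 ob \<tau>0 \<tau>1 by simp
qed

end

section \<open>Reading fusion rules off the Grothendieck ring\<close>

context fusion_category
begin

lemma simple_classes_rep:
  assumes "K \<in> simple_classes C"
  shows "simple_object C (SOME s. s \<in> K)" "iso_class C (SOME s. s \<in> K) = K"
proof -
  obtain r where r: "simple_object C r" "K = iso_class C r"
    using assms by (auto simp: simple_classes_def)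
  then have rO: "r \<in> Obj C" by (simp add: simple_object_def)
  then have "r \<in> K" using r isomorphic_refl by (simp add: iso_class_def)
  then have s: "(SOME s. s \<in> K) \<in> K" by (rule someI)
  then have iso: "isomorphic C r (SOME s. s \<in> K)" using r by (simp add: iso_class_def)
  show "simple_object C (SOME s. s \<in> K)" by (rule simple_object_isomorphic[OF iso r(1)])
  show "iso_class C (SOME s. s \<in> K) = K"
    using iso iso_class_eq_iff[of r "SOME s. s \<in> K"] isomorphic_obj[OF iso] r by simp
qed

lemma lookup_grothendieck_class:
  "poly_mapping.lookup (grothendieck_class C x) K =
    (if K \<in> simple_classes C then int (multiplicity_in C x K) else 0)"
  unfolding grothendieck_class_def
  by (simp add: lookup_sum finitely_many_simples if_distrib cong: if_cong)

lemma grothendieck_class_in_carrier: "grothendieck_class C x \<in> carrier (grothendieck_ring C)"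
  by (auto simp: grothendieck_ring_def free_based_ring_def in_keys_iff lookup_grothendieck_class
      split: if_splits)

context
  fixes h :: "('o set \<Rightarrow>\<^sub>0 int) \<Rightarrow> ('b \<Rightarrow>\<^sub>0 int)" and e :: 'b
    and m :: "'b \<Rightarrow> 'b \<Rightarrow> 'b \<Rightarrow>\<^sub>0 int"
  assumes h: "h \<in> ring_iso (grothendieck_ring C) (free_based_ring UNIV e m)"
    and h_basis: "h ` basis (grothendieck_ring C) = basis (free_based_ring UNIV e m)"
begin

text \<open>
  The isomorphism matches the basis elements of the target ring with the classes of simple objects, and
  chosen representatives of these classes label the simple objects by basis elements.
\<close>

definition label_class :: "'b \<Rightarrow> 'o set" where
  "label_class b = (SOME K. K \<in> simple_classes C \<and> h (frag_of K) = frag_of b)"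

definition label_obj :: "'b \<Rightarrow> 'o" where
  "label_obj b = (SOME s. s \<in> label_class b)"

lemma label_class: "label_class b \<in> simple_classes C" "h (frag_of (label_class b)) = frag_of b"
proof -
  have "frag_of b \<in> h ` basis (grothendieck_ring C)"
    unfolding h_basis by (simp add: free_based_ring_def)
  then have "\<exists>K. K \<in> simple_classes C \<and> h (frag_of K) = frag_of b"
    by (auto simp: grothendieck_ring_def free_based_ring_def)
  from someI_ex[OF this]
  show "label_class b \<in> simple_classes C" "h (frag_of (label_class b)) = frag_of b"
    by (auto simp: label_class_def)
qed

lemma label_class_eq_iff: "label_class b = label_class c \<longleftrightarrow> b = c"
  using label_class(2)[of b] label_class(2)[of c] frag_of_eq by metis

lemma label_obj: "simple_object C (label_obj b)" "iso_class C (label_obj b) = label_class b"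
  "label_obj b \<in> Obj C"
  using simple_classes_rep[OF label_class(1)] by (auto simp: label_obj_def simple_object_def)

lemma isomorphic_label_obj_iff: "isomorphic C (label_obj b) (label_obj c) \<longleftrightarrow> b = c"
  using iso_class_eq_iff[OF label_obj(3)[of b] label_obj(3)[of c]]
  by (simp add: label_obj(2) label_class_eq_iff)

lemma inj_h: "inj_on h (carrier (grothendieck_ring C))"
  using h by (auto simp: ring_iso_def bij_betw_def)

lemma label_obj_unit: "isomorphic C \<I> (label_obj e)"
proof -
  have I: "iso_class C \<I> \<in> simple_classes C" using unit_simple by (auto simp: simple_classes_def)
  have "h (frag_of (iso_class C \<I>)) = frag_of e"
    using h by (auto simp: ring_iso_def ring_hom_def grothendieck_ring_def free_based_ring_def)
  then have "frag_of (iso_class C \<I>) = frag_of (label_class e)"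
    using I label_class by (intro inj_onD[OF inj_h])
      (auto simp: grothendieck_ring_def free_based_ring_def)
  then have "iso_class C \<I> = label_class e" by (simp add: frag_of_eq)
  then show ?thesis using iso_class_eq_iff[OF unit_closed label_obj(3)[of e]] label_obj(2)[of e] by simp
qed

text \<open>
  The isomorphism \<open>h\<close> is additive on sums of basis elements and injective, so structure constants can be
  pulled back along it.
\<close>

lemma label_tensor_class:
  assumes D: "finite D" and mD: "m b c = (\<Sum>d\<in>D. frag_of d)"
  shows "grothendieck_class C (label_obj b \<boxdot> label_obj c) = (\<Sum>d\<in>D. frag_of (label_class d))"
proof -
  let ?G = "grothendieck_ring C" and ?R = "free_based_ring UNIV e m"
  have hom: "h \<in> ring_hom ?G ?R" using h by (simp add: ring_iso_def)
  have cG: "carrier ?G = {x. Poly_Mapping.keys x \<subseteq> simple_classes C}"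
    by (simp add: grothendieck_ring_def free_based_ring_def)
  have h_add: "h (x + y) = h x + h y" if "x \<in> carrier ?G" "y \<in> carrier ?G" for x y
    using ring_hom_add[OF hom that] by (simp add: grothendieck_ring_def free_based_ring_def)
  have cl: "frag_of (label_class b) \<in> carrier ?G" for b using label_class(1)[of b] by (simp add: cG)
  have sum_cl: "(\<Sum>d\<in>D'. frag_of (label_class d)) \<in> carrier ?G" if "finite D'" for D'
    using that cl
    by (induction D') (auto simp: cG dest!: subsetD[OF keys_add])
  have h_0: "h 0 = 0" using h_add[of 0 0] by (simp add: cG)
  have h_sum: "h (\<Sum>d\<in>D'. frag_of (label_class d)) = (\<Sum>d\<in>D'. frag_of d)" if "finite D'" for D'
    using that by (induction D') (simp_all add: h_0 h_add[OF cl sum_cl] label_class(2))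
  have "h (frag_of (label_class b) \<otimes>\<^bsub>?G\<^esub> frag_of (label_class c)) = frag_of b \<otimes>\<^bsub>?R\<^esub> frag_of c"
    using ring_hom_mult[OF hom cl cl, of b c] by (simp add: label_class(2))
  also have "\<dots> = h (\<Sum>d\<in>D. frag_of (label_class d))"
    using D mD by (simp add: h_sum free_based_ring_def)
  also have "frag_of (label_class b) \<otimes>\<^bsub>?G\<^esub> frag_of (label_class c) =
      grothendieck_class C (label_obj b \<boxdot> label_obj c)"
    by (simp add: grothendieck_ring_def free_based_ring_def label_obj_def)
  finally show ?thesis
    by (rule inj_onD[OF inj_h]) (use grothendieck_class_in_carrier sum_cl D in auto)
qed

lemma label_tensor_count:
  assumes D: "finite D" and mD: "m b c = (\<Sum>d\<in>D. frag_of d)"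
    and dec: "simple_decomposition C (label_obj b \<boxdot> label_obj c) ss" and r: "simple_object C r"
  shows "length (filter (\<lambda>s. s \<in> iso_class C r) ss) = (if iso_class C r \<in> label_class ` D then 1 else 0)"
proof -
  have rc: "iso_class C r \<in> simple_classes C" using r by (auto simp: simple_classes_def)
  have "int (length (filter (\<lambda>s. s \<in> iso_class C r) ss)) =
      poly_mapping.lookup (grothendieck_class C (label_obj b \<boxdot> label_obj c)) (iso_class C r)"
    using rc multiplicity_in_eq[OF dec r] by (simp add: lookup_grothendieck_class)
  also have "\<dots> = (\<Sum>d\<in>D. if iso_class C r = label_class d then 1 else 0)"
    unfolding label_tensor_class[OF D mD] by (simp add: lookup_sum)
  also have "\<dots> = (\<Sum>K\<in>label_class ` D. if iso_class C r = K then 1 else 0)"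
    by (subst sum.reindex) (auto intro!: inj_onI simp: label_class_eq_iff)
  also have "\<dots> = (if iso_class C r \<in> label_class ` D then 1 else 0)"
    using D by simp
  finally show ?thesis by (simp split: if_splits)
qed

lemma label_tensor_summand:
  assumes D: "finite D" and mD: "m b c = (\<Sum>d\<in>D. frag_of d)"
    and dec: "simple_decomposition C (label_obj b \<boxdot> label_obj c) ss" and s: "s \<in> set ss"
  shows "\<exists>d\<in>D. isomorphic C (label_obj d) s"
proof -
  have ss: "simple_object C s" using dec s by (simp add: simple_decomposition_def)
  then have sO: "s \<in> Obj C" by (simp add: simple_object_def)
  then have "s \<in> iso_class C s" using isomorphic_refl by (simp add: iso_class_def)
  then have "filter (\<lambda>t. t \<in> iso_class C s) ss \<noteq> []" using s by (auto simp: filter_empty_conv)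
  then have "iso_class C s \<in> label_class ` D"
    using label_tensor_count[OF D mD dec ss] by (auto split: if_splits)
  then obtain d where "d \<in> D" "iso_class C s = iso_class C (label_obj d)" by (auto simp: label_obj(2))
  then show ?thesis using iso_class_eq_iff[OF label_obj(3) sO] by metis
qed

lemma label_tensor_simple:
  assumes mD: "m b c = frag_of d"
  shows "isomorphic C (label_obj b \<boxdot> label_obj c) (label_obj d)"
proof -
  have D: "finite {d}" "m b c = (\<Sum>d\<in>{d}. frag_of d)" using mD by simp_all
  obtain ss where dec: "simple_decomposition C (label_obj b \<boxdot> label_obj c) ss"
    using semisimple label_obj(3) tensor_obj_closed by blast
  have all: "s \<in> iso_class C (label_obj d)" if "s \<in> set ss" for s
    using label_tensor_summand[OF D dec that] isomorphic_obj by (auto simp: iso_class_def)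
  then have "filter (\<lambda>s. s \<in> iso_class C (label_obj d)) ss = ss" by simp
  then have "length ss = 1" using label_tensor_count[OF D dec label_obj(1), of d] by (simp add: label_obj(2))
  then obtain s where "ss = [s]" by (auto simp: length_Suc_conv)
  then have "isomorphic C (label_obj b \<boxdot> label_obj c) s" "isomorphic C (label_obj d) s"
    using dec direct_sum_singleton all by (auto simp: simple_decomposition_def iso_class_def)
  then show ?thesis using isomorphic_trans isomorphic_sym by blast
qed

text \<open>
  For \<open>p = q\<close> this covers the case of a self-dual \<open>p\<close>, and for \<open>p \<noteq> q\<close> that of two objects dual to each
  other.
\<close>

lemma no_based_ring_isomorphism:
  assumes dist: "distinct [e, x, y, z]"
    and m1: "m y x = frag_of e" "m x x = frag_of y" "m x z = frag_of z"
      "m x p = frag_of p" "m p x = frag_of p" "m x q = frag_of q"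
    and m4: "m p q = (\<Sum>d\<in>{e, x, y, z}. frag_of d)" "m q p = (\<Sum>d\<in>{e, x, y, z}. frag_of d)"
  shows False
proof -
  let ?o = label_obj
  obtain ss where dec: "simple_decomposition C (?o p \<boxdot> ?o q) ss"
    using semisimple label_obj(3) tensor_obj_closed by blast
  obtain ts where dec': "simple_decomposition C (?o q \<boxdot> ?o p) ts"
    using semisimple label_obj(3) tensor_obj_closed by blast
  have unit_iff: "isomorphic C \<I> a \<longleftrightarrow> isomorphic C (?o e) a" for a
    using label_obj_unit isomorphic_trans isomorphic_sym by blast
  have unit_class: "iso_class C \<I> = iso_class C (?o e)"
    by (simp add: iso_class_def unit_iff)
  have fin: "finite {e, x, y, z}" by simp
  have once: "length (filter (\<lambda>s. s \<in> iso_class C (?o d)) us) = 1"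
    if "d \<in> {e, x, y, z}" "m b c = (\<Sum>d\<in>{e, x, y, z}. frag_of d)"
      "simple_decomposition C (?o b \<boxdot> ?o c) us" for d b c us
    using label_tensor_count[OF fin that(2,3) label_obj(1), of d] that(1) by (auto simp: label_obj(2))
  have "filter (\<lambda>s. s \<in> iso_class C (?o e)) ts \<noteq> []"
    using once[OF _ m4(2) dec', of e] by auto
  then obtain t0 where t0: "t0 \<in> set ts" "isomorphic C (?o e) t0"
    by (auto simp: filter_empty_conv iso_class_def)
  have only: "\<exists>r\<in>{\<I>, ?o x, ?o y, ?o z}. isomorphic C r s" if "s \<in> set ss" for s
    using label_tensor_summand[OF fin m4(1) dec that] by (auto simp: unit_iff)
  have once': "length (filter (\<lambda>s. s \<in> iso_class C r) ss) = 1" if "r \<in> {\<I>, ?o x, ?o y, ?o z}" for r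
  proof -
    obtain d where "d \<in> {e, x, y, z}" "iso_class C r = iso_class C (?o d)"
      using \<open>r \<in> {\<I>, ?o x, ?o y, ?o z}\<close> unit_class by auto
    then show ?thesis using once[OF _ m4(1) dec, of d] by simp
  qed
  show False
  proof (rule no_compatible_fusion_rules[OF label_obj(1)[of p] label_obj(1)[of q]
        label_obj(1)[of x] label_obj(1)[of y] label_obj(1)[of z] _ label_tensor_simple[OF m1(2)]
        label_tensor_simple[OF m1(3)] label_tensor_simple[OF m1(4)] label_tensor_simple[OF m1(5)]
        label_tensor_simple[OF m1(6)] _ _ dec only once' dec' t0(1)])
    show "isomorphic C (?o y \<boxdot> ?o x) \<I>"
      using label_tensor_simple[OF m1(1)] isomorphic_sym[OF label_obj_unit] isomorphic_trans by blast
    show "\<not> isomorphic C \<I> (?o y)" "\<not> isomorphic C (?o x) (?o y)"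
      using dist by (auto simp: unit_iff isomorphic_label_obj_iff)
    show "isomorphic C \<I> t0" using t0(2) unit_iff by simp
  qed
qed

end

end

theorem theorem4p1:
  "\<not> (\<exists>C :: ('o, 'm) tensor_data. fusion_category C \<and>
      (based_ring_isomorphic (grothendieck_ring C) R7 \<or>
       based_ring_isomorphic (grothendieck_ring C) R8))"
proof
  assume "\<exists>C :: ('o, 'm) tensor_data. fusion_category C \<and>
      (based_ring_isomorphic (grothendieck_ring C) R7 \<or>
       based_ring_isomorphic (grothendieck_ring C) R8)"
  then obtain C :: "('o, 'm) tensor_data" where "fusion_category C"
    and iso: "based_ring_isomorphic (grothendieck_ring C) R7 \<or>
       based_ring_isomorphic (grothendieck_ring C) R8" by blast
  interpret fusion_category C by fact
  from iso show False
  proof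
    assume "based_ring_isomorphic (grothendieck_ring C) R7"
    then obtain h where "h \<in> ring_iso (grothendieck_ring C) R7"
      "h ` basis (grothendieck_ring C) = basis R7"
      by (auto simp: based_ring_isomorphic_def)
    from no_based_ring_isomorphism[OF this[unfolded R7_def], of BX BY BZ BM BM]
    show False by (simp add: add_ac)
  next
    assume "based_ring_isomorphic (grothendieck_ring C) R8"
    then obtain h where "h \<in> ring_iso (grothendieck_ring C) R8"
      "h ` basis (grothendieck_ring C) = basis R8"
      by (auto simp: based_ring_isomorphic_def)
    from no_based_ring_isomorphism[OF this[unfolded R8_def], of BX BY BZ BM BN]
    show False by (simp add: add_ac)
  qed
qed

end
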